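(* Let $\Gamma$ be a 2-dimensional space group whose linear part $\Gamma_1$ is a group of rotations and which has a generic lattice, and let $(G=(V,E),\psi)$ be a finite $\Gamma$-gain graph. Then for almost all $p:V\to\mathbb{R}^2$, $\dim_{\mathbb{R}}\operatorname{span}\{R'_{e,\psi}(p)\mid e\in E\}=\hat h_\Gamma(E)$, where $$h_\Gamma(F)=2|V(F)|-2c(F)+\dim_{\mathbb{R}}\operatorname{span}\{U_{e,\psi_F^\circ}\mid e\in E(G_F^\circ)\}-1\qquad(F\subseteq E).$$
   Context: Space group in $\mathbb{R}^2$: discrete cocompact subgroup $\Gamma$ of the Euclidean group; $\gamma=(A_\gamma,t_\gamma)$, $A_\gamma$ orthogonal, acts by $q\mapsto A_\gamma q+t_\gamma$, product $(A,t)(A',t')=(AA',At'+t)$. $B_\Gamma$ = matrix whose columns generate the translation lattice; $K_\gamma=B_\Gamma^{-1}A_\gamma B_\Gamma$; $\Gamma_1=\{A_\gamma\}$; $\mathbb{Q}_{\Gamma_1}$ = field generated by $\mathbb{Q}$ and entries of $\Gamma_1$. $\overline{\mathrm{Lat}}(\Gamma)=\{B\in\mathbb{R}^{2\times2}:BK_\gamma=A_\gamma B\ \forall\gamma\}$, $k$ its dimension, basis $B_1,\dots,B_k$; generic lattice: $B_\Gamma=\sum s_iB_i$ with $s_i$ algebraically independent over $\mathbb{Q}_{\Gamma_1}$. $b(\alpha,t)=(\langle\alpha,B_iB_\Gamma^{-1}t\rangle)_{i=1}^k$. $C_{\pi/2}$ is the rotation by $\pi/2$. $\Gamma$-gain graph: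 $G$ finite directed (loops, parallel edges allowed), $\psi_e=\psi(e)=(A_{\psi_e},t_{\psi_e})$, reversing an edge inverts the gain. $V(F)$, $c(F)$ = number of components of $(V(F),F)$. Switching at $v$ with $\gamma$: non-loop edges out of $v$ get $\gamma\psi(e)$, into $v$ get $\psi(e)\gamma^{-1}$, loops at $v$ get $\gamma\psi(e)\gamma^{-1}$. Compressed graph $(G_F^\circ,\psi_F^\circ)$: switch $\psi$ to $\psi_F^\circ$ that is the identity on a maximal forest of $F$, then contract each component of $(V(F),F)$ to a vertex, edges of $F$ becoming loops. In $(\mathbb{R}^2)^W\oplus\mathbb{R}^k$ ($W$ vertex set, $x(\ast)$ the $\mathbb{R}^k$-part), for gains $\phi_e=(A_{\phi_e},t_{\phi_e})$: non-loop $e$ from $i$ to $j$: $U_{e,\phi}=\{x:x(i)+A_{\phi_e}x(j)=0,\ b(x(i),t_{\phi_e})+x(\ast)=0,\ x(w)=0\ \forall w\ne i,j\}$; loop at $i$: $U_{e,\phi}=\{x:\exists\alpha,\ x(i)=(I_2-A_{\phi_e})\alpha,\ x(\ast)=-b(\alpha,t_{\phi_e}),\ x(w)=0\ \forall w\ne i\}$. For $e$ from $i$ to $j$ in $G$ (possibly $i=j$): $R'_{e,\psi}(p)=U_{e,\psi}\cap\{x:\langle C_{\pi/2}(p(i)-(A_{\psi_e}p(j)+t_{\psi_e})),x(i)\rangle=0\}$. Dilworth truncation: $F_+=\{e\in F:h(\{e\})\ge0\}$, $\hat h(F)=\min\sum_ih(F_i)$ over partitions of $F_+$ into nonempty parts,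 $0$ if $F_+=\emptyset$.
   Formalization: The loop formulas, with which the claim fails, are corrected: in U for a loop, x(i)=(I−A⁻¹)α replaces x(i)=(I−A)α; in R' for a loop, the orthogonality condition is imposed on the parameter α instead of on x(i). *)

theory Defs
  imports "HOL-Analysis.Analysis" "HOL-Algebra.Coset" "HOL-Library.Disjoint_Sets"
begin

section \<open>Space groups in the plane\<close>

text \<open>The pair \<open>(A, t)\<close> stands for the map \<open>q \<mapsto> A q + t\<close>.\<close>

type_synonym isom = "(real^2^2) \<times> (real^2)"

definition euclid :: "isom monoid" where
  "euclid = \<lparr>carrier = {(A, t). orthogonal_matrix A},
             mult = (\<lambda>(A, t) (A', t'). (A ** A', A *v t' + t)),
             one = (mat 1, 0)\<rparr>"

lemma group_euclid: "group euclid"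
proof (rule groupI)
  fix x assume "x \<in> carrier euclid"
  then obtain A t where x: "x = (A, t)" and A: "orthogonal_matrix A"
    by (auto simp: euclid_def)
  have "(transpose A, - (transpose A *v t)) \<otimes>\<^bsub>euclid\<^esub> x = \<one>\<^bsub>euclid\<^esub>"
    using A by (auto simp: x euclid_def orthogonal_matrix)
  moreover have "(transpose A, - (transpose A *v t)) \<in> carrier euclid"
    using A by (simp add: euclid_def)
  ultimately show "\<exists>y\<in>carrier euclid. y \<otimes>\<^bsub>euclid\<^esub> x = \<one>\<^bsub>euclid\<^esub>" by blast
qed (auto simp: euclid_def orthogonal_matrix_mul orthogonal_matrix_id matrix_mul_assoc
       matrix_vector_mul_assoc matrix_vector_right_distrib)

text \<open>Cocompactness is compactness of the space of cosets, with the quotient topology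
  (which the quotient map determines uniquely).\<close>

definition space_group :: "isom set \<Rightarrow> bool" where
  "space_group \<Gamma> \<longleftrightarrow> subgroup \<Gamma> euclid \<and> discrete \<Gamma> \<and>
     (\<exists>Q. quotient_map (top_of_set (carrier euclid)) Q (\<lambda>g. \<Gamma> #>\<^bsub>euclid\<^esub> g) \<and> compact_space Q)"

definition linear_part :: "isom set \<Rightarrow> (real^2^2) set" where
  "linear_part \<Gamma> = fst ` \<Gamma>"

definition lattice_matrix :: "isom set \<Rightarrow> real^2^2 \<Rightarrow> bool" where
  "lattice_matrix \<Gamma> B \<longleftrightarrow> invertible B \<and>
     {t. (mat 1, t) \<in> \<Gamma>} = range (\<lambda>z :: int^2. B *v (\<chi> i. of_int (z $ i)))"

definition Kmat :: "real^2^2 \<Rightarrow> isom \<Rightarrow> real^2^2" where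
  "Kmat B \<gamma> = matrix_inv B ** fst \<gamma> ** B"

definition Lat :: "isom set \<Rightarrow> real^2^2 \<Rightarrow> (real^2^2) set" where
  "Lat \<Gamma> B = {M. \<forall>\<gamma>\<in>\<Gamma>. M ** Kmat B \<gamma> = fst \<gamma> ** M}"

text \<open>A basis of \<open>Lat \<Gamma> B\<close> is indexed by a finite type \<open>'k\<close>, so that \<open>k = CARD('k)\<close> is
  the dimension of \<open>Lat \<Gamma> B\<close>.\<close>

definition Lat_basis :: "isom set \<Rightarrow> real^2^2 \<Rightarrow> ('k::finite \<Rightarrow> real^2^2) \<Rightarrow> bool" where
  "Lat_basis \<Gamma> B Bs \<longleftrightarrow> inj Bs \<and> independent (range Bs) \<and> span (range Bs) = Lat \<Gamma> B"

definition real_subfield :: "real set \<Rightarrow> bool" where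
  "real_subfield K \<longleftrightarrow> 1 \<in> K \<and> (\<forall>x\<in>K. \<forall>y\<in>K. x - y \<in> K \<and> x * y \<in> K) \<and> (\<forall>x\<in>K. inverse x \<in> K)"

definition entry_field :: "isom set \<Rightarrow> real set" where
  "entry_field \<Gamma> = real_subfield hull {A $ i $ j | A i j. A \<in> linear_part \<Gamma>}"

text \<open>The function \<open>c\<close> lists the coefficients of a polynomial in variables indexed by \<open>'k\<close>;
  \<open>m\<close> is the exponent vector of a monomial.\<close>

definition alg_independent_over :: "real set \<Rightarrow> ('k::finite \<Rightarrow> real) \<Rightarrow> bool" where
  "alg_independent_over K s \<longleftrightarrow>
     (\<forall>c :: ('k \<Rightarrow> nat) \<Rightarrow> real.
        finite {m. c m \<noteq> 0} \<and> range c \<subseteq> K \<and> (\<Sum>m | c m \<noteq> 0. c m * (\<Prod>i\<in>UNIV. s i ^ m i)) = 0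
        \<longrightarrow> (\<forall>m. c m = 0))"

definition generic_lattice :: "isom set \<Rightarrow> real^2^2 \<Rightarrow> ('k::finite \<Rightarrow> real^2^2) \<Rightarrow> bool" where
  "generic_lattice \<Gamma> B Bs \<longleftrightarrow>
     (\<exists>s. B = (\<Sum>i\<in>UNIV. s i *\<^sub>R Bs i) \<and> alg_independent_over (entry_field \<Gamma>) s)"

definition bvec :: "real^2^2 \<Rightarrow> ('k::finite \<Rightarrow> real^2^2) \<Rightarrow> real^2 \<Rightarrow> real^2 \<Rightarrow> real^'k" where
  "bvec B Bs \<alpha> t = (\<chi> i. \<alpha> \<bullet> ((Bs i ** matrix_inv B) *v t))"

definition rot90 :: "real^2^2" where
  "rot90 = vector [vector [0, -1], vector [1, 0]]"


section \<open>Gain graphs\<close>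

record ('v, 'e) gain_graph =
  verts :: "'v set"
  edges :: "'e set"
  src :: "'e \<Rightarrow> 'v"
  tgt :: "'e \<Rightarrow> 'v"
  gain :: "'e \<Rightarrow> isom"

definition finite_gain_graph :: "isom set \<Rightarrow> ('v, 'e) gain_graph \<Rightarrow> bool" where
  "finite_gain_graph \<Gamma> G \<longleftrightarrow> finite (verts G) \<and> finite (edges G) \<and>
     (\<forall>e\<in>edges G. src G e \<in> verts G \<and> tgt G e \<in> verts G \<and> gain G e \<in> \<Gamma>)"

definition edge_verts :: "('v, 'e) gain_graph \<Rightarrow> 'e set \<Rightarrow> 'v set" where
  "edge_verts G F = src G ` F \<union> tgt G ` F"

definition component :: "('v, 'e) gain_graph \<Rightarrow> 'e set \<Rightarrow> 'v \<Rightarrow> 'v set" where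
  "component G F v = {w. (v, w) \<in> ({(src G e, tgt G e) | e. e \<in> F} \<union> {(tgt G e, src G e) | e. e \<in> F})\<^sup>*}"

definition components :: "('v, 'e) gain_graph \<Rightarrow> 'e set \<Rightarrow> 'v set set" where
  "components G F = component G F ` edge_verts G F"

text \<open>Cycles ignore orientations; a loop is a cycle of length 1 and two parallel edges
  form a cycle of length 2.\<close>

definition is_cycle :: "('v, 'e) gain_graph \<Rightarrow> 'v list \<Rightarrow> 'e list \<Rightarrow> bool" where
  "is_cycle G vs es \<longleftrightarrow> es \<noteq> [] \<and> length vs = length es \<and> distinct vs \<and> distinct es \<and>
     (\<forall>i<length es. {src G (es ! i), tgt G (es ! i)} = {vs ! i, vs ! (Suc i mod length es)})"

definition forest :: "('v, 'e) gain_graph \<Rightarrow> 'e set \<Rightarrow> bool" where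
  "forest G T \<longleftrightarrow> (\<nexists>vs es. set es \<subseteq> T \<and> is_cycle G vs es)"

definition maximal_forest :: "('v, 'e) gain_graph \<Rightarrow> 'e set \<Rightarrow> 'e set \<Rightarrow> bool" where
  "maximal_forest G F T \<longleftrightarrow> T \<subseteq> F \<and> forest G T \<and> (\<forall>T'. T \<subseteq> T' \<and> T' \<subseteq> F \<and> forest G T' \<longrightarrow> T' = T)"

definition switch :: "'v \<Rightarrow> isom \<Rightarrow> ('v, 'e) gain_graph \<Rightarrow> ('v, 'e) gain_graph" where
  "switch v \<gamma> G = G\<lparr>gain := (\<lambda>e.
     if src G e = v \<and> tgt G e = v then \<gamma> \<otimes>\<^bsub>euclid\<^esub> gain G e \<otimes>\<^bsub>euclid\<^esub> inv\<^bsub>euclid\<^esub> \<gamma>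
     else if src G e = v then \<gamma> \<otimes>\<^bsub>euclid\<^esub> gain G e
     else if tgt G e = v then gain G e \<otimes>\<^bsub>euclid\<^esub> inv\<^bsub>euclid\<^esub> \<gamma>
     else gain G e)\<rparr>"

inductive switching_equiv ::
  "isom set \<Rightarrow> ('v, 'e) gain_graph \<Rightarrow> ('v, 'e) gain_graph \<Rightarrow> bool" for \<Gamma> G where
  switching_refl: "switching_equiv \<Gamma> G G"
| switching_step: "switching_equiv \<Gamma> G H \<Longrightarrow> v \<in> verts G \<Longrightarrow> \<gamma> \<in> \<Gamma> \<Longrightarrow> switching_equiv \<Gamma> G (switch v \<gamma> H)"

definition compressing_gain ::
  "isom set \<Rightarrow> ('v, 'e) gain_graph \<Rightarrow> 'e set \<Rightarrow> ('e \<Rightarrow> isom) \<Rightarrow> bool" where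
  "compressing_gain \<Gamma> G F \<psi> \<longleftrightarrow> switching_equiv \<Gamma> G (G\<lparr>gain := \<psi>\<rparr>) \<and>
     (\<exists>T. maximal_forest G F T \<and> (\<forall>e\<in>T. \<psi> e = \<one>\<^bsub>euclid\<^esub>))"

definition compressed_graph ::
  "('v, 'e) gain_graph \<Rightarrow> 'e set \<Rightarrow> ('e \<Rightarrow> isom) \<Rightarrow> ('v set, 'e) gain_graph" where
  "compressed_graph G F \<psi> =
     \<lparr>verts = components G F, edges = F,
      src = (\<lambda>e. component G F (src G e)), tgt = (\<lambda>e. component G F (tgt G e)), gain = \<psi>\<rparr>"


section \<open>The subspaces attached to the edges\<close>

text \<open>The ambient space is \<open>(\<real>\<^sup>2)\<^sup>W \<oplus> \<real>\<^sup>k\<close>. All subspaces below vanish outside the end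
  vertices of an edge, so \<open>W\<close> may be any finite type containing the vertex set.

  The vector of a loop with parameter \<open>\<alpha>\<close> arises by identifying the two ends of a non-loop edge
  with the same gain \<open>(A, t)\<close>: there \<open>x(i) = \<alpha>\<close> and \<open>x(j) = - A\<inverse> \<alpha>\<close>, which add up to
  \<open>(I - A\<inverse>) \<alpha>\<close>, and \<open>x(*) = - b(\<alpha>, t)\<close>. The inverse is essential. With \<open>(I - A) \<alpha>\<close> instead the
  subspace of a loop would change when the loop is reversed and its gain inverted, and the
  dimension of a sum of such subspaces would change under switching.
  The two versions agree if \<open>A\<^sup>2 = I\<close>.\<close>

definition loop_vec :: "real^2^2 \<Rightarrow> ('k::finite \<Rightarrow> real^2^2) \<Rightarrow> 'w::finite \<Rightarrow> isom \<Rightarrow> real^2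
    \<Rightarrow> ((real^2)^'w) \<times> (real^'k)" where
  "loop_vec B Bs i \<phi> \<alpha> =
     ((\<chi> w. if w = i then (mat 1 - matrix_inv (fst \<phi>)) *v \<alpha> else 0), - bvec B Bs \<alpha> (snd \<phi>))"

definition U :: "real^2^2 \<Rightarrow> ('k::finite \<Rightarrow> real^2^2) \<Rightarrow> ('w::finite, 'e) gain_graph \<Rightarrow> 'e
    \<Rightarrow> (((real^2)^'w) \<times> (real^'k)) set" where
  "U B Bs G e =
     (let i = src G e; j = tgt G e; A = fst (gain G e); t = snd (gain G e) in
      if i \<noteq> j then
        {(x, y). x $ i + A *v (x $ j) = 0 \<and> bvec B Bs (x $ i) t + y = 0 \<and>
                 (\<forall>w. w \<noteq> i \<and> w \<noteq> j \<longrightarrow> x $ w = 0)}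
      else {loop_vec B Bs i (gain G e) \<alpha> | \<alpha>. True})"

text \<open>The hyperplane condition restricts \<open>U\<close> to the vectors whose direction is parallel to
  \<open>p(i) - (A p(j) + t)\<close>. The direction is \<open>x(i)\<close> for a non-loop edge, but for a loop it is
  the parameter \<open>\<alpha>\<close>: the coordinate \<open>x(i) = (I - A\<inverse>) \<alpha>\<close> vanishes for a translation, so that a
  condition on \<open>x(i)\<close> would be void and would leave the whole two-dimensional \<open>U\<close>.\<close>

definition R' :: "real^2^2 \<Rightarrow> ('k::finite \<Rightarrow> real^2^2) \<Rightarrow> ('w::finite, 'e) gain_graph \<Rightarrow> ('w \<Rightarrow> real^2)
    \<Rightarrow> 'e \<Rightarrow> (((real^2)^'w) \<times> (real^'k)) set" where
  "R' B Bs G p e =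
     (let i = src G e; j = tgt G e; A = fst (gain G e); t = snd (gain G e);
          d = p i - (A *v p j + t) in
      if i \<noteq> j then U B Bs G e \<inter> {(x, y). (rot90 *v d) \<bullet> (x $ i) = 0}
      else {loop_vec B Bs i (gain G e) \<alpha> | \<alpha>. (rot90 *v d) \<bullet> \<alpha> = 0})"


section \<open>The rank formula\<close>

definition dilworth :: "('e set \<Rightarrow> int) \<Rightarrow> 'e set \<Rightarrow> int" where
  "dilworth h F =
     (let P = {e \<in> F. 0 \<le> h {e}} in
      if P = {} then 0 else Min {(\<Sum>X\<in>\<P>. h X) | \<P>. partition_on P \<P>})"

text \<open>The argument \<open>\<psi>c\<close> chooses, for each \<open>F\<close>, the switched gain function used to
  compress \<open>F\<close>.\<close>

definition h\<Gamma> :: "real^2^2 \<Rightarrow> ('k::finite \<Rightarrow> real^2^2) \<Rightarrow> ('v::finite, 'e) gain_graph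
    \<Rightarrow> ('e set \<Rightarrow> 'e \<Rightarrow> isom) \<Rightarrow> 'e set \<Rightarrow> int" where
  "h\<Gamma> B Bs G \<psi>c F =
     2 * int (card (edge_verts G F)) - 2 * int (card (components G F))
     + int (dim (span (\<Union>e\<in>edges (compressed_graph G F (\<psi>c F)). U B Bs (compressed_graph G F (\<psi>c F)) e)))
     - 1"

end

(*
  For an edge e with ends i, j and gain (A, t) let L_e map a to the vector of U_e with x(i) = a (for a
  loop, to the one with parameter a).
  The adjoint of L_e is D_e (x, N) = x(i) - A x(j) - N B^(-1) t, where N ranges over the lattice
  matrices sum_l nu_l B_l.  Hence n^perp cuts U_e in the line spanned by u_e(n) = L_e J D_e n, with
  J the rotation by pi/2, and R'_e(p) is this line for n = (J^(-1) p, J^(-1) B).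

  For generic n the dimension of the span of such hyperplane sections is given by Lovasz's theorem:
  it is the minimum, over all partitions of the edge set, of the sum of dim span U_F - 1.
  Here the lattice part of n is fixed, but this costs no genericity.  If N is invertible, then
  Z = N B^(-1) J commutes with the linear parts, and Z takes placements over J^(-1) B to placements
  over N without changing the linear dependences.

  Finally dim span U_F is invariant under switching, and contracting the components of F, when the
  gains are the identity on a spanning forest, kills exactly the vectors supported on V(F) whose sum
  over each component vanishes, a space of dimension 2 |V(F)| - 2 c(F).  Hence
  h(F) = dim span U_F - 1.
*)
theory Submission
  imports Defs
begin

section \<open>Generic hyperplane sections\<close>

text \<open>The plane enters through the skew symmetry of \<open>rot90\<close>:
  \<open>section_vec e\<close> is \<open>L e\<close> after \<open>rot90\<close> after the adjoint of
  \<open>L e\<close>, hence a skew operator in the normal vector. This forces a generic minimal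
  dependent set of section vectors to span all that its flats cut out of the hyperplane. Edge sets
  with that property unite when they share an edge, so the maximal ones partition the edges, and
  their partition attains the minimum in Lovasz's theorem. The obstacle is that this argument needs
  dependences that persist on an open set of normal vectors, lattice part included, while a random
  \<open>p\<close> moves the vertex part only. The transfer by \<open>Z\<close> closes this gap; it
  requires \<open>rot90\<close> to commute with the linear part, and that is where rotations are
  used. What remains is a finite number of polynomial conditions on \<open>p\<close>, for single
  edges and for edge sets that are independent at some admissible normal vector. The edges dropped
  by the truncation are those whose subspace is zero.\<close>

definition lin_indep_family :: "'i set \<Rightarrow> ('i \<Rightarrow> 'a::real_vector) \<Rightarrow> bool" where
  "lin_indep_family I v \<longleftrightarrow> (\<forall>c. (\<Sum>i\<in>I. c i *\<^sub>R v i) = 0 \<longrightarrow> (\<forall>i\<in>I. c i = 0))"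

lemma lin_indep_familyD:
  assumes "lin_indep_family I v" "(\<Sum>i\<in>I. c i *\<^sub>R v i) = 0" "i \<in> I"
  shows "c i = 0"
  using assms unfolding lin_indep_family_def by blast

lemma lin_indep_family_subset:
  assumes "lin_indep_family I v" "J \<subseteq> I" "finite I"
  shows "lin_indep_family J v"
  unfolding lin_indep_family_def
proof (intro allI impI)
  fix c assume c: "(\<Sum>i\<in>J. c i *\<^sub>R v i) = 0"
  have "(\<Sum>i\<in>I. (if i \<in> J then c i else 0) *\<^sub>R v i) = (\<Sum>i\<in>J. c i *\<^sub>R v i)"
    using assms by (intro sum.mono_neutral_cong_right) auto
  with c have z: "(\<Sum>i\<in>I. (if i \<in> J then c i else 0) *\<^sub>R v i) = 0" by simp
  show "\<forall>i\<in>J. c i = 0"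
  proof
    fix i assume "i \<in> J"
    then show "c i = 0" using lin_indep_familyD[OF assms(1) z, of i] assms(2) by (simp add: subsetD)
  qed
qed

text \<open>Families are used instead of sets because two edges with the same section vector must
  count as dependent; this is the injectivity on the right.\<close>

lemma lin_indep_family_iff:
  assumes "finite I"
  shows "lin_indep_family I v \<longleftrightarrow> inj_on v I \<and> independent (v ` I)"
proof
  assume l: "lin_indep_family I v"
  have inj: "inj_on v I"
  proof (rule inj_onI, rule ccontr)
    fix i j assume ij: "i \<in> I" "j \<in> I" "v i = v j" "i \<noteq> j"
    have "(\<Sum>k\<in>I. (if k = i then 1 else if k = j then - 1 else 0) *\<^sub>R v k)
        = (\<Sum>k\<in>{i, j}. (if k = i then 1 else if k = j then - 1 else 0) *\<^sub>R v k)"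
      using assms ij by (intro sum.mono_neutral_cong_right) auto
    also have "\<dots> = 0" using ij by simp
    finally have z: "(\<Sum>k\<in>I. (if k = i then 1 else if k = j then - 1 else 0) *\<^sub>R v k) = 0" .
    show False using lin_indep_familyD[OF l z ij(1)] by simp
  qed
  moreover have "independent (v ` I)"
  proof (rule independent_if_scalars_zero)
    fix f x assume f: "(\<Sum>x\<in>v ` I. f x *\<^sub>R x) = 0" and x: "x \<in> v ` I"
    have "(\<Sum>i\<in>I. f (v i) *\<^sub>R v i) = 0" using f by (simp add: sum.reindex[OF inj])
    then show "f x = 0" using lin_indep_familyD[OF l, of "\<lambda>i. f (v i)"] x by auto
  qed (use assms in auto)
  ultimately show "inj_on v I \<and> independent (v ` I)" by blast
next
  assume r: "inj_on v I \<and> independent (v ` I)"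
  show "lin_indep_family I v" unfolding lin_indep_family_def
  proof (intro allI impI)
    fix c assume c: "(\<Sum>i\<in>I. c i *\<^sub>R v i) = 0"
    let ?f = "\<lambda>x. c (inv_into I v x)"
    have "(\<Sum>x\<in>v ` I. ?f x *\<^sub>R x) = (\<Sum>i\<in>I. c i *\<^sub>R v i)"
      using r by (simp add: sum.reindex)
    also note c
    finally have z: "(\<Sum>x\<in>v ` I. ?f x *\<^sub>R x) = 0" .
    show "\<forall>i\<in>I. c i = 0"
    proof
      fix i assume "i \<in> I"
      then show "c i = 0"
        using independentD[OF conjunct2[OF r] _ subset_refl z, of "v i"] assms r by simp
    qed
  qed
qed

lemma lin_indep_family_dim:
  assumes "finite I" "lin_indep_family I v"
  shows "dim (span (v ` I)) = card I"
  using assms lin_indep_family_iff[OF assms(1), of v]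
  by (simp add: card_image dim_eq_card_independent)

lemma lin_indep_family_basis:
  assumes "finite F"
  obtains I where "I \<subseteq> F" "lin_indep_family I v" "v ` F \<subseteq> span (v ` I)"
proof -
  obtain S where S: "S \<subseteq> v ` F" "independent S" "v ` F \<subseteq> span S"
    using maximal_independent_subset by blast
  obtain I where "I \<subseteq> F" "inj_on v I" "S = v ` I"
    using S(1) subset_image_inj[of S v F] by auto
  with S(2) have "lin_indep_family I v"
    unfolding lin_indep_family_iff[OF finite_subset[OF \<open>I \<subseteq> F\<close> assms]] by simp
  then show thesis using that \<open>I \<subseteq> F\<close> \<open>S = v ` I\<close> S(3) by blast
qed

section \<open>Hyperplanes, the quarter turn and compactness of coefficients\<close>

lemma dim_hyperplane_section:
  fixes n :: "'a::euclidean_space"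
  assumes "subspace S" "w \<in> S" "w \<bullet> n \<noteq> 0"
  shows "dim S = dim (S \<inter> {x. x \<bullet> n = 0}) + 1"
proof -
  have sub: "subspace (S \<inter> {x. x \<bullet> n = 0})"
    using assms(1) by (auto simp: subspace_def inner_left_distrib)
  have wn: "w \<notin> span (S \<inter> {x. x \<bullet> n = 0})"
    unfolding span_eq_iff[THEN iffD2, OF sub] using assms(3) by simp
  have "span (insert w (S \<inter> {x. x \<bullet> n = 0})) = S"
  proof
    show "span (insert w (S \<inter> {x. x \<bullet> n = 0})) \<subseteq> S"
      using assms by (intro span_minimal) auto
    show "S \<subseteq> span (insert w (S \<inter> {x. x \<bullet> n = 0}))"
    proof
      fix x assume x: "x \<in> S"
      have "(x - (x \<bullet> n / (w \<bullet> n)) *\<^sub>R w) \<bullet> n = 0"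
        using assms(3) by (simp add: inner_diff_left)
      moreover have "x - (x \<bullet> n / (w \<bullet> n)) *\<^sub>R w \<in> S"
        by (intro subspace_diff subspace_scale assms x)
      ultimately have "x - (x \<bullet> n / (w \<bullet> n)) *\<^sub>R w \<in> S \<inter> {x. x \<bullet> n = 0}" by blast
      from span_base[OF this] show "x \<in> span (insert w (S \<inter> {x. x \<bullet> n = 0}))"
        unfolding span_breakdown_eq by (rule exI)
    qed
  qed
  then have "dim S = dim (span (insert w (S \<inter> {x. x \<bullet> n = 0})))" by (rule arg_cong[OF sym])
  also have "\<dots> = dim (S \<inter> {x. x \<bullet> n = 0}) + 1"
    unfolding dim_span dim_insert if_not_P[OF wn] ..
  finally show ?thesis .
qed

lemma rot90_nth [simp]: "(rot90 *v a) $ 1 = - a $ 2" "(rot90 *v a) $ 2 = a $ 1"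
  by (simp_all add: rot90_def matrix_vector_mult_def sum_2)

lemma inner_real2: "(a::real^2) \<bullet> b = a $ 1 * b $ 1 + a $ 2 * b $ 2"
  by (simp add: inner_vec_def sum_2)

lemma rot90_inner_swap: "(rot90 *v a) \<bullet> b = - ((rot90 *v b) \<bullet> a)"
  by (simp add: inner_real2)

lemma rot90_inner_self [simp]: "(rot90 *v a) \<bullet> a = 0"
  by (simp add: inner_real2)

lemma parallel_if_rot90_orthogonal:
  assumes "(rot90 *v a) \<bullet> b = 0" "a \<noteq> 0"
  shows "\<exists>c. b = c *\<^sub>R a"
proof -
  have eq: "a $ 1 * b $ 2 = a $ 2 * b $ 1" using assms(1) by (simp add: inner_real2)
  have "a $ 1 \<noteq> 0 \<or> a $ 2 \<noteq> 0" using assms(2) by (auto simp: vec_eq_iff forall_2)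
  then show ?thesis
  proof
    assume "a $ 1 \<noteq> 0"
    then have "b = (b $ 1 / a $ 1) *\<^sub>R a" using eq by (simp add: vec_eq_iff forall_2 field_simps)
    then show ?thesis ..
  next
    assume "a $ 2 \<noteq> 0"
    then have "b = (b $ 2 / a $ 2) *\<^sub>R a" using eq by (simp add: vec_eq_iff forall_2 field_simps)
    then show ?thesis ..
  qed
qed

lemma parallel_rot90_if_orthogonal:
  assumes "a \<bullet> b = 0" "a \<noteq> 0"
  shows "\<exists>c. b = c *\<^sub>R (rot90 *v a)"
proof -
  have "(rot90 *v (rot90 *v a)) \<bullet> b = 0" using assms(1) by (simp add: inner_real2)
  moreover have "rot90 *v a \<noteq> 0" using assms(2) by (auto simp: vec_eq_iff forall_2)
  ultimately show ?thesis by (rule parallel_if_rot90_orthogonal)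
qed

text \<open>Coefficients of relations are indexed by a set of edges and not by a finite type, so
  Bolzano-Weierstrass is iterated over the indices.\<close>

lemma bounded_family_convergent_subsequence:
  fixes c :: "nat \<Rightarrow> 'i \<Rightarrow> real"
  assumes "finite I" "\<And>k i. i \<in> I \<Longrightarrow> \<bar>c k i\<bar> \<le> b"
  obtains l r where "strict_mono (r :: nat \<Rightarrow> nat)" "\<And>i. i \<in> I \<Longrightarrow> (\<lambda>k. c (r k) i) \<longlonglongrightarrow> l i"
  using assms
proof (induction I arbitrary: thesis rule: finite_induct)
  case empty
  show ?case by (rule empty.prems(1)[of id]) (auto simp: strict_mono_def)
next
  case (insert j I)
  obtain r l where r: "strict_mono r" "\<And>i. i \<in> I \<Longrightarrow> (\<lambda>k. c (r k) i) \<longlonglongrightarrow> l i"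
    using insert.IH insert.prems(2) by blast
  have "bounded (range (\<lambda>k. c (r k) j))"
    using insert.prems(2) by (auto simp: bounded_iff)
  then obtain m r' where r': "strict_mono r'" "((\<lambda>k. c (r k) j) \<circ> r') \<longlonglongrightarrow> m"
    using bounded_imp_convergent_subsequence by blast
  have "(\<lambda>k. c ((r \<circ> r') k) i) \<longlonglongrightarrow> (if i = j then m else l i)" if "i \<in> insert j I" for i
    using that r'(2) LIMSEQ_subseq_LIMSEQ[OF r(2) r'(1)] insert.hyps(2) by (auto simp: o_def)
  then show ?case by (rule insert.prems(1)[OF strict_mono_o[OF r(1) r'(1)]])
qed

section \<open>Flats of dimension at most two, their hyperplane sections and circuits\<close>

text \<open>Graphs and gains are hidden here: an edge is only a flat \<open>range (L e)\<close> with
  a parametrisation and its adjoint. \<open>L e\<close> may fail to be injective, since the subspace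
  of a loop can degenerate.\<close>

locale planar_sections =
  fixes L :: "'e \<Rightarrow> real^2 \<Rightarrow> 'a::euclidean_space" and D :: "'e \<Rightarrow> 'a \<Rightarrow> real^2"
  assumes linear_L: "linear (L e)"
    and linear_D: "linear (D e)"
    and adjoint_eq: "L e a \<bullet> n = a \<bullet> D e n"
begin

definition section_vec :: "'e \<Rightarrow> 'a \<Rightarrow> 'a" where
  "section_vec e n = L e (rot90 *v D e n)"

lemma linear_section_vec: "linear (section_vec e)"
proof -
  have "section_vec e = L e \<circ> ((*v) rot90 \<circ> D e)" by (simp add: section_vec_def fun_eq_iff)
  then show ?thesis
    by (simp only: linear_compose linear_L linear_D matrix_vector_mul_linear)
qed

text \<open>By adjointness both sides are values of the form \<open>(rot90 *v a) \<bullet> b\<close>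
  at \<open>D e x\<close> and \<open>D e q\<close>, and \<open>rot90\<close> is skew.\<close>

lemma section_vec_skew: "q \<bullet> section_vec e x = - (x \<bullet> section_vec e q)"
  unfolding section_vec_def
  by (simp add: inner_commute[of _ "L e _"] adjoint_eq) (rule rot90_inner_swap)

lemma section_vec_orthogonal: "section_vec e n \<bullet> n = 0"
  by (simp add: section_vec_def adjoint_eq)

text \<open>If \<open>D e n\<close> were zero, the whole flat would lie in the hyperplane while the
  section vector vanishes. Otherwise the admissible parameters are the line orthogonal to
  \<open>D e n\<close>, which the quarter turn of \<open>D e n\<close> spans.\<close>

lemma in_span_section_vec:
  assumes "x \<in> range (L e)" "x \<bullet> n = 0" "D e n \<noteq> 0"
  shows "\<exists>c. x = c *\<^sub>R section_vec e n"
proof -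
  obtain a where a: "x = L e a" using assms(1) by blast
  have "D e n \<bullet> a = 0" using assms(2) adjoint_eq[of e a n] inner_commute[of a "D e n"]
      by (simp add: a)
  then obtain c where "a = c *\<^sub>R (rot90 *v D e n)"
      using assms(3) parallel_rot90_if_orthogonal by blast
  then show ?thesis by (auto simp: a section_vec_def linear_cmul[OF linear_L])
qed

text \<open>The linear relation is the limit of normalised relations at \<open>n0 + x / k\<close>. Pairing those with \<open>q\<close>
  leaves only the terms in \<open>x\<close>, which survive the division by \<open>1 / k\<close>.\<close>

lemma circuit_relation_limit:
  assumes fin: "finite C" and X: "open X" "n0 \<in> X"
    and dep: "\<And>n. n \<in> X \<Longrightarrow> \<not> lin_indep_family C (\<lambda>e. section_vec e n)"
    and q: "\<And>e. e \<in> C \<Longrightarrow> q \<bullet> section_vec e n0 = 0"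
  obtains c where "\<exists>e\<in>C. c e \<noteq> 0" "(\<Sum>e\<in>C. c e *\<^sub>R section_vec e n0) = 0"
    "(\<Sum>e\<in>C. c e * (q \<bullet> section_vec e x)) = 0"
proof -
  have seq0: "(\<lambda>k. n0 + inverse (real (Suc k)) *\<^sub>R x) \<longlonglongrightarrow> n0 + 0 *\<^sub>R x"
    by (intro tendsto_intros LIMSEQ_inverse_real_of_nat)
  then have "eventually (\<lambda>k. n0 + inverse (real (Suc k)) *\<^sub>R x \<in> X) sequentially"
    using X by (intro topological_tendstoD) auto
  then obtain K where K: "\<And>k. k \<ge> K \<Longrightarrow> n0 + inverse (real (Suc k)) *\<^sub>R x \<in> X"
    unfolding eventually_sequentially by blast
  define t where "t k = inverse (real (Suc (k + K)))" for k
  define m where "m k = n0 + t k *\<^sub>R x" for k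
  have m: "m k \<in> X" for k using K[of "k + K"] by (simp add: m_def t_def)
  have m_lim: "m \<longlonglongrightarrow> n0"
    using LIMSEQ_ignore_initial_segment[OF seq0, of K] by (simp add: m_def[abs_def] t_def)
  have t: "t k \<noteq> 0" for k by (simp add: t_def)
  have "\<exists>c. (\<Sum>e\<in>C. c e *\<^sub>R section_vec e (m k)) = 0 \<and> (\<Sum>e\<in>C. \<bar>c e\<bar>) = 1" for k
  proof -
    obtain d e where d: "(\<Sum>e\<in>C. d e *\<^sub>R section_vec e (m k)) = 0" "e \<in> C" "d e \<noteq> 0"
      using dep[OF m] unfolding lin_indep_family_def by blast
    \<comment> \<open>Total absolute weight 1 survives the limit, so the limiting coefficients
      cannot all vanish.\<close>
    define s where "s = (\<Sum>e\<in>C. \<bar>d e\<bar>)"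
    have s: "s > 0" unfolding s_def
      using sum_pos2[OF fin d(2), of "\<lambda>e. \<bar>d e\<bar>"] d(3) by simp
    have "(\<Sum>e\<in>C. (d e / s) *\<^sub>R section_vec e (m k))
        = (1 / s) *\<^sub>R (\<Sum>e\<in>C. d e *\<^sub>R section_vec e (m k))"
      by (simp add: scaleR_sum_right)
    moreover have "(\<Sum>e\<in>C. \<bar>d e / s\<bar>) = 1"
      using s by (simp add: abs_divide sum_divide_distrib[symmetric]) (simp add: s_def)
    ultimately show ?thesis using d(1) by (intro exI[of _ "\<lambda>e. d e / s"]) simp
  qed
  then obtain c where c: "\<And>k. (\<Sum>e\<in>C. c k e *\<^sub>R section_vec e (m k)) = 0"
    "\<And>k. (\<Sum>e\<in>C. \<bar>c k e\<bar>) = 1" by metis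
  have c_q: "(\<Sum>e\<in>C. c k e * (q \<bullet> section_vec e x)) = 0" for k
  proof -
    have "0 = q \<bullet> (\<Sum>e\<in>C. c k e *\<^sub>R section_vec e (m k))" by (simp only: c(1) inner_zero_right)
    also have "\<dots> = (\<Sum>e\<in>C. t k * (c k e * (q \<bullet> section_vec e x)))"
      unfolding inner_sum_right
      by (intro sum.cong refl)
        (simp add: m_def linear_add[OF linear_section_vec] linear_cmul[OF linear_section_vec]
          inner_add_right q)
    also have "\<dots> = t k * (\<Sum>e\<in>C. c k e * (q \<bullet> section_vec e x))"
      by (rule sum_distrib_left[symmetric])
    finally show ?thesis using t[of k] by simp
  qed
  have "\<bar>c k e\<bar> \<le> 1" if "e \<in> C" for k e
    using member_le_sum[of e C "\<lambda>e. \<bar>c k e\<bar>"] that fin c(2)[of k] by simp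
  then obtain l r where r: "strict_mono (r :: nat \<Rightarrow> nat)"
    and l: "\<And>e. e \<in> C \<Longrightarrow> (\<lambda>k. c (r k) e) \<longlonglongrightarrow> l e"
    using bounded_family_convergent_subsequence[OF fin, of c 1] by blast
  show thesis
  proof (rule that[of l])
    have "(\<lambda>k. \<Sum>e\<in>C. \<bar>c (r k) e\<bar>) \<longlonglongrightarrow> (\<Sum>e\<in>C. \<bar>l e\<bar>)"
      by (intro tendsto_intros l)
    then have "(\<Sum>e\<in>C. \<bar>l e\<bar>) = 1" by (simp add: c(2) LIMSEQ_const_iff)
    then show "\<exists>e\<in>C. l e \<noteq> 0" by (metis abs_zero sum.neutral zero_neq_one)
    have "(\<lambda>k. \<Sum>e\<in>C. c (r k) e *\<^sub>R section_vec e (m (r k)))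
        \<longlonglongrightarrow> (\<Sum>e\<in>C. l e *\<^sub>R section_vec e n0)"
      using LIMSEQ_subseq_LIMSEQ[OF m_lim r] unfolding o_def
      by (intro tendsto_intros l bounded_linear.tendsto[OF linear_conv_bounded_linear[THEN iffD1,
          OF linear_section_vec]])
    then show "(\<Sum>e\<in>C. l e *\<^sub>R section_vec e n0) = 0"
      by (simp add: c(1) LIMSEQ_const_iff)
    have "(\<lambda>k. \<Sum>e\<in>C. c (r k) e * (q \<bullet> section_vec e x))
        \<longlonglongrightarrow> (\<Sum>e\<in>C. l e * (q \<bullet> section_vec e x))"
      by (intro tendsto_intros l)
    then show "(\<Sum>e\<in>C. l e * (q \<bullet> section_vec e x)) = 0"
      by (simp add: c_q LIMSEQ_const_iff)
  qed
qed

text \<open>Let \<open>c\<close> be the relation of the circuit at \<open>n0\<close> and let \<open>q\<close> be orthogonal to all sections. Then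
  \<open>D e q = \<lambda>\<^sub>e D e n0\<close>, and by the limit relation and skew symmetry \<open>c\<^sub>e \<lambda>\<^sub>e\<close> is again a relation. So
  \<open>\<lambda>\<^sub>e = \<lambda>\<close> is constant, and \<open>q - \<lambda> n0\<close> is orthogonal to the span of the flats.\<close>

lemma section_span_eq_if_circuit:
  assumes fin: "finite C" and X: "open X" "n0 \<in> X"
    and dep: "\<And>n. n \<in> X \<Longrightarrow> \<not> lin_indep_family C (\<lambda>e. section_vec e n)"
    and ind: "\<And>e. e \<in> C \<Longrightarrow> lin_indep_family (C - {e}) (\<lambda>e. section_vec e n0)"
    and nz: "\<And>e. e \<in> C \<Longrightarrow> D e n0 \<noteq> 0"
    and x: "x \<in> span (\<Union>e\<in>C. range (L e))" "x \<bullet> n0 = 0"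
  shows "x \<in> span ((\<lambda>e. section_vec e n0) ` C)"
proof -
  let ?u = "\<lambda>e. section_vec e n0"
  \<comment> \<open>In a circuit every nontrivial relation has full support, since removing one edge
    leaves an independent family.\<close>
  have full: "c e \<noteq> 0" if c: "(\<Sum>e\<in>C. c e *\<^sub>R ?u e) = 0" "\<exists>e\<in>C. c e \<noteq> 0" and e: "e \<in> C" for c e
  proof
    assume "c e = 0"
    then have "(\<Sum>e\<in>C - {e}. c e *\<^sub>R ?u e) = 0"
      using c(1) sum.remove[OF fin e, of "\<lambda>e. c e *\<^sub>R ?u e"] by simp
    then have "\<forall>e'\<in>C - {e}. c e' = 0" using lin_indep_familyD[OF ind[OF e]] by blast
    then show False using c(2) \<open>c e = 0\<close> by blast
  qed
  obtain c0 e0 where c0: "(\<Sum>e\<in>C. c0 e *\<^sub>R ?u e) = 0" and e0: "e0 \<in> C" "c0 e0 \<noteq> 0"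
    using dep[OF X(2)] unfolding lin_indep_family_def by blast
  \<comment> \<open>The relations of a circuit form a line: subtracting the multiple of
    \<open>c0\<close> that cancels the coefficient at \<open>e0\<close> leaves a relation without
    full support. Hence limits taken in different directions \<open>y\<close> all give multiples of
    the same \<open>c0\<close>.\<close>
  have proportional: "c e = (c e0 / c0 e0) * c0 e"
    if c: "(\<Sum>e\<in>C. c e *\<^sub>R ?u e) = 0" and e: "e \<in> C" for c e
  proof (rule ccontr)
    assume ne: "c e \<noteq> (c e0 / c0 e0) * c0 e"
    let ?d = "\<lambda>e. c e - (c e0 / c0 e0) * c0 e"
    have "(\<Sum>e\<in>C. ?d e *\<^sub>R ?u e)
        = (\<Sum>e\<in>C. c e *\<^sub>R ?u e) - (c e0 / c0 e0) *\<^sub>R (\<Sum>e\<in>C. c0 e *\<^sub>R ?u e)"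
      by (simp add: scaleR_diff_left sum_subtractf scaleR_sum_right)
    then have "(\<Sum>e\<in>C. ?d e *\<^sub>R ?u e) = 0" by (simp only: c c0) simp
    from full[OF this _ e0(1)] e ne e0(2) show False by auto
  qed
  have orth: "x \<bullet> q = 0" if q: "\<And>e. e \<in> C \<Longrightarrow> q \<bullet> ?u e = 0" for q
  proof -
    have rel: "(\<Sum>e\<in>C. c0 e * (q \<bullet> section_vec e y)) = 0" for y
    proof -
      obtain c where c: "\<exists>e\<in>C. c e \<noteq> 0" "(\<Sum>e\<in>C. c e *\<^sub>R ?u e) = 0"
        "(\<Sum>e\<in>C. c e * (q \<bullet> section_vec e y)) = 0"
        using circuit_relation_limit[OF fin X dep q] by blast
      have "c e0 \<noteq> 0" by (rule full[OF c(2,1) e0(1)])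
      have "0 = (\<Sum>e\<in>C. c e * (q \<bullet> section_vec e y))" by (simp only: c(3))
      also have "\<dots> = (\<Sum>e\<in>C. (c e0 / c0 e0) * (c0 e * (q \<bullet> section_vec e y)))"
        using proportional[OF c(2)] by (intro sum.cong refl) (metis mult.assoc)
      also have "\<dots> = (c e0 / c0 e0) * (\<Sum>e\<in>C. c0 e * (q \<bullet> section_vec e y))"
        by (rule sum_distrib_left[symmetric])
      finally show ?thesis using \<open>c e0 \<noteq> 0\<close> e0(2) by simp
    qed
    have "\<exists>l. D e q = l *\<^sub>R D e n0" if e: "e \<in> C" for e
    proof -
      have "(rot90 *v D e n0) \<bullet> D e q = 0"
        using q[OF e] by (simp add: section_vec_def inner_commute[of q] adjoint_eq)
      then show ?thesis using nz[OF e] by (rule parallel_if_rot90_orthogonal)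
    qed
    then obtain l where l: "\<And>e. e \<in> C \<Longrightarrow> D e q = l e *\<^sub>R D e n0" by metis
    have sv: "section_vec e q = l e *\<^sub>R ?u e" if "e \<in> C" for e
      unfolding section_vec_def
      by (simp add: l[OF that] matrix_vector_mult_scaleR linear_cmul[OF linear_L])
    have "y \<bullet> (\<Sum>e\<in>C. (c0 e * l e) *\<^sub>R ?u e) = 0" for y
    proof -
      have "y \<bullet> (\<Sum>e\<in>C. (c0 e * l e) *\<^sub>R ?u e) = (\<Sum>e\<in>C. c0 e * (y \<bullet> section_vec e q))"
        unfolding inner_sum_right by (intro sum.cong refl) (simp add: sv)
      also have "\<dots> = - (\<Sum>e\<in>C. c0 e * (q \<bullet> section_vec e y))"
        unfolding sum_negf[symmetric]
        by (intro sum.cong refl) (simp add: section_vec_skew[of y _ q])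
      finally show ?thesis using rel[of y] by simp
    qed
    then have z: "(\<Sum>e\<in>C. (c0 e * l e) *\<^sub>R ?u e) = 0" using inner_eq_zero_iff by blast
    have l_const: "l e = l e0" if e: "e \<in> C" for e
    proof -
      have "c0 e \<noteq> 0" using full[OF c0 _ e] e0 by blast
      then show ?thesis using proportional[OF z e] e0(2) by simp
    qed
    have "D e (q - l e0 *\<^sub>R n0) = 0" if e: "e \<in> C" for e
      by (simp add: linear_diff[OF linear_D] linear_cmul[OF linear_D] l[OF e] l_const[OF e])
    then have "y \<bullet> (q - l e0 *\<^sub>R n0) = 0" if "y \<in> (\<Union>e\<in>C. range (L e))" for y
      using that by (auto simp: adjoint_eq)
    then have "(q - l e0 *\<^sub>R n0) \<bullet> x = 0"
      by (intro orthogonal_to_span[OF x(1), unfolded orthogonal_def]) (simp add: inner_commute)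
    then show ?thesis using x(2) inner_commute[of q x] inner_commute[of n0 x]
        by (simp add: inner_diff_left)
  qed
  \<comment> \<open>The part \<open>z\<close> of \<open>x\<close> orthogonal to the sections is an
    admissible \<open>q\<close>, so \<open>orth\<close> makes it orthogonal to \<open>x\<close> and
    therefore zero.\<close>
  obtain y z where yz: "y \<in> span (?u ` C)" "\<And>w. w \<in> span (?u ` C) \<Longrightarrow> orthogonal z w" "x = y + z"
  proof (rule orthogonal_subspace_decomp_exists[of "?u ` C" x])
    fix y z
    assume "y \<in> span (?u ` C)" "\<And>w. w \<in> span (?u ` C) \<Longrightarrow> orthogonal z w" "x = y + z"
    then show thesis by (rule that)
  qed
  have "x \<bullet> z = 0"
    by (rule orth) (rule yz(2)[OF span_base[OF imageI], unfolded orthogonal_def])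
  moreover have "z \<bullet> y = 0" using yz(1,2) by (simp add: orthogonal_def)
  ultimately have "z = 0" by (simp add: yz(3) inner_add_left inner_commute[of y])
  then show ?thesis using yz by simp
qed

section \<open>Tight edge sets and Lovasz's theorem\<close>

definition flat_span :: "'e set \<Rightarrow> 'a set" where
  "flat_span F = span (\<Union>e\<in>F. range (L e))"

definition section_span :: "'a \<Rightarrow> 'e set \<Rightarrow> 'a set" where
  "section_span n F = span ((\<lambda>e. section_vec e n) ` F)"

text \<open>The reverse inclusion is \<open>section_span_subset\<close>. Tight sets are thus those
  whose sections have the largest span that their flats permit.\<close>

definition tight :: "'a \<Rightarrow> 'e set \<Rightarrow> bool" where
  "tight n F \<longleftrightarrow> flat_span F \<inter> {x. x \<bullet> n = 0} \<subseteq> section_span n F"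

lemma section_span_mono: "F \<subseteq> F' \<Longrightarrow> section_span n F \<subseteq> section_span n F'"
  unfolding section_span_def by (intro span_mono) blast

lemma section_span_subset: "section_span n F \<subseteq> flat_span F \<inter> {x. x \<bullet> n = 0}"
  unfolding section_span_def
proof (rule span_minimal)
  show "(\<lambda>e. section_vec e n) ` F \<subseteq> flat_span F \<inter> {x. x \<bullet> n = 0}"
    by (auto simp: flat_span_def section_vec_orthogonal)
      (auto simp: section_vec_def intro: span_base)
  show "subspace (flat_span F \<inter> {x. x \<bullet> n = 0})"
    unfolding flat_span_def
    by (intro subspace_inter subspace_span) (simp add: subspace_def inner_add_left)
qed

lemma tight_singleton:
  assumes "D e n \<noteq> 0"
  shows "tight n {e}"
  unfolding tight_def
proof
  fix x assume x: "x \<in> flat_span {e} \<inter> {x. x \<bullet> n = 0}"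
  have sp: "span (range (L e)) = range (L e)"
    by (intro span_eq_iff[THEN iffD2] linear_subspace_image linear_L subspace_UNIV)
  then have "x \<in> range (L e)" "x \<bullet> n = 0"
      using x by (simp_all add: flat_span_def sp del: span_eq_iff)
  then obtain c where "x = c *\<^sub>R section_vec e n" using in_span_section_vec assms by blast
  then show "x \<in> section_span n {e}" by (simp add: section_span_def span_base span_scale)
qed

lemma flat_span_not_orthogonal:
  assumes "e \<in> F" "D e n \<noteq> 0"
  shows "L e (D e n) \<in> flat_span F" "L e (D e n) \<bullet> n \<noteq> 0"
  using assms by (auto simp: flat_span_def adjoint_eq intro: span_base)

text \<open>The flat of the common edge contains a vector off the hyperplane, available to both
  sides. Write \<open>x\<close> in the joint section as \<open>a + b\<close>; moving a multiple of
  that vector from \<open>a\<close> to \<open>b\<close> puts both summands into the hyperplane,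
  where tightness of each side applies.\<close>

lemma tight_Un:
  assumes "tight n F1" "tight n F2" "e \<in> F1" "e \<in> F2" "D e n \<noteq> 0"
  shows "tight n (F1 \<union> F2)"
  unfolding tight_def
proof
  fix x assume x: "x \<in> flat_span (F1 \<union> F2) \<inter> {x. x \<bullet> n = 0}"
  let ?w = "L e (D e n)"
  note w1 = flat_span_not_orthogonal[OF assms(3,5)]
  note w2 = flat_span_not_orthogonal[OF assms(4,5)]
  have "flat_span (F1 \<union> F2) = {a + b |a b. a \<in> flat_span F1 \<and> b \<in> flat_span F2}"
    unfolding flat_span_def UN_Un span_Un by auto
  then obtain a b where ab: "x = a + b" "a \<in> flat_span F1" "b \<in> flat_span F2" using x by blast
  define r where "r = (a \<bullet> n) / (?w \<bullet> n)"
  have r: "r * (?w \<bullet> n) = a \<bullet> n" using w1(2) by (simp add: r_def)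
  have "a - r *\<^sub>R ?w \<in> flat_span F1" using ab(2) w1(1) unfolding flat_span_def
    by (intro span_diff span_scale)
  moreover have "(a - r *\<^sub>R ?w) \<bullet> n = 0" by (simp add: inner_diff_left r)
  ultimately have a: "a - r *\<^sub>R ?w \<in> section_span n F1" using assms(1) by (auto simp: tight_def)
  have "b + r *\<^sub>R ?w \<in> flat_span F2" using ab(3) w2(1) unfolding flat_span_def
    by (intro span_add span_scale)
  moreover have "(b + r *\<^sub>R ?w) \<bullet> n = 0" using x by (simp add: inner_add_left r ab(1))
  ultimately have b: "b + r *\<^sub>R ?w \<in> section_span n F2" using assms(2) by (auto simp: tight_def)
  have "(a - r *\<^sub>R ?w) + (b + r *\<^sub>R ?w) \<in> section_span n (F1 \<union> F2)"
    using a b section_span_mono[of F1 "F1 \<union> F2" n] section_span_mono[of F2 "F1 \<union> F2" n]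
    unfolding section_span_def by (blast intro: span_add)
  then show "x \<in> section_span n (F1 \<union> F2)" by (simp add: ab(1))
qed

lemma tight_Union:
  assumes "finite \<F>" "\<F> \<noteq> {}" "\<And>F. F \<in> \<F> \<Longrightarrow> tight n F \<and> e \<in> F" "D e n \<noteq> 0"
  shows "tight n (\<Union>\<F>)"
  using assms(1-3)
proof (induction \<F> rule: finite_ne_induct)
  case (insert F \<F>)
  then have "e \<in> \<Union>\<F>" by blast
  then show ?case using tight_Un[of n F "\<Union>\<F>" e] insert assms(4) by simp
qed simp

text \<open>This is the origin of the \<open>- 1\<close> in the formula. The hyperplane really cuts
  the span down because \<open>L e (D e n)\<close> pairs with \<open>n\<close> to the squared norm
  of \<open>D e n\<close>.\<close>

lemma dim_section_span_le:
  assumes "e \<in> F" "D e n \<noteq> 0"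
  shows "int (dim (section_span n F)) \<le> int (dim (flat_span F)) - 1"
    and "tight n F \<Longrightarrow> int (dim (section_span n F)) = int (dim (flat_span F)) - 1"
proof -
  have d: "dim (flat_span F) = dim (flat_span F \<inter> {x. x \<bullet> n = 0}) + 1"
    by (rule dim_hyperplane_section[OF _ flat_span_not_orthogonal[OF assms]])
      (simp add: flat_span_def)
  show "int (dim (section_span n F)) \<le> int (dim (flat_span F)) - 1"
    using d dim_subset[OF section_span_subset[of n F]] by simp
  assume "tight n F"
  then have "section_span n F = flat_span F \<inter> {x. x \<bullet> n = 0}"
    using section_span_subset[of n F] by (auto simp: tight_def)
  then show "int (dim (section_span n F)) = int (dim (flat_span F)) - 1" using d by simp
qed

lemma dim_section_span_subadditive:
  assumes "finite \<P>"
  shows "dim (section_span n (\<Union>\<P>)) \<le> (\<Sum>F\<in>\<P>. dim (section_span n F))"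
  using assms
proof (induction \<P> rule: finite_induct)
  case (insert F \<P>)
  have "section_span n (\<Union>(insert F \<P>))
      = {x + y |x y. x \<in> section_span n F \<and> y \<in> section_span n (\<Union>\<P>)}"
    unfolding section_span_def by (simp add: image_Un span_Un)
  then have "dim (section_span n (\<Union>(insert F \<P>)))
      \<le> dim (section_span n F) + dim (section_span n (\<Union>\<P>))"
    using dim_sums_Int[of "section_span n F" "section_span n (\<Union>\<P>)"]
    by (simp add: section_span_def)
  then show ?case using insert by simp
qed (simp add: section_span_def)

text \<open>A dependence would contain a circuit. A generic circuit is tight, so
  \<open>closed\<close> places it inside a single block, hence inside the independent set chosen for
  that block.\<close>

lemma lin_indep_UN_tight_bases:
  assumes fin: "finite P" and part: "partition_on P \<P>"
    and closed: "\<And>C F. C \<subseteq> P \<Longrightarrow> tight n0 C \<Longrightarrow> F \<in> \<P> \<Longrightarrow> C \<inter> F \<noteq> {} \<Longrightarrow> C \<subseteq> F"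
    and J: "\<And>F. F \<in> \<P> \<Longrightarrow> J F \<subseteq> F \<and> lin_indep_family (J F) (\<lambda>e. section_vec e n0)"
    and X: "open X" "n0 \<in> X"
    and nz: "\<And>e. e \<in> P \<Longrightarrow> D e n0 \<noteq> 0"
    and generic: "\<And>I n. I \<subseteq> P \<Longrightarrow> n \<in> X \<Longrightarrow> lin_indep_family I (\<lambda>e. section_vec e n)
                    \<Longrightarrow> lin_indep_family I (\<lambda>e. section_vec e n0)"
  shows "lin_indep_family (\<Union>F\<in>\<P>. J F) (\<lambda>e. section_vec e n0)"
proof (rule ccontr)
  assume dep: "\<not> ?thesis"
  let ?I = "\<Union>F\<in>\<P>. J F"
  let ?u = "\<lambda>e. section_vec e n0"
  have IP: "?I \<subseteq> P" using J part by (fastforce simp: partition_on_def)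
  then have finI: "finite ?I" using fin finite_subset by blast
  define \<C> where "\<C> = {C \<in> Pow ?I. \<not> lin_indep_family C ?u}"
  have "finite \<C>" "\<C> \<noteq> {}" using finI dep by (auto simp: \<C>_def)
  then obtain C where C: "C \<in> \<C>" and min: "\<And>C'. C' \<in> \<C> \<Longrightarrow> C' \<subseteq> C \<Longrightarrow> C' = C"
    using finite_has_minimal[of \<C>] by metis
  have CI: "C \<subseteq> ?I" and C_dep: "\<not> lin_indep_family C ?u" using C by (auto simp: \<C>_def)
  have finC: "finite C" using CI finI finite_subset by blast
  have "C \<noteq> {}" using C_dep by (auto simp: lin_indep_family_def)
  then obtain e where e: "e \<in> C" by blast
  then obtain F where F: "F \<in> \<P>" "e \<in> J F" using CI by blast
  have "tight n0 C" unfolding tight_def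
  proof
    fix x assume x: "x \<in> flat_span C \<inter> {x. x \<bullet> n0 = 0}"
    have "lin_indep_family (C - {e}) ?u" if "e \<in> C" for e
      using min[of "C - {e}"] that CI by (auto simp: \<C>_def)
    \<comment> \<open>The circuit argument perturbs \<open>n0\<close>, so dependence at
      \<open>n0\<close> alone is too little; \<open>generic\<close> spreads it over all of
      \<open>X\<close>.\<close>
    moreover have "\<not> lin_indep_family C (\<lambda>e. section_vec e n)" if "n \<in> X" for n
      using generic[OF _ that, of C] C_dep CI IP by blast
    ultimately show "x \<in> section_span n0 C"
      using section_span_eq_if_circuit[OF finC X, of x] x nz CI IP
      unfolding flat_span_def section_span_def by blast
  qed
  then have "C \<subseteq> F" using closed[of C F] CI IP F e J by blast
  have "C \<subseteq> J F"
  proof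
    fix f assume f: "f \<in> C"
    then obtain F' where F': "F' \<in> \<P>" "f \<in> J F'" using CI by blast
    then have "f \<in> F' \<inter> F" using J[OF F'(1)] f \<open>C \<subseteq> F\<close> by blast
    then have "F' = F"
      using part F(1) F'(1) unfolding partition_on_def disjoint_def by blast
    then show "f \<in> J F" using F' by simp
  qed
  moreover have "finite (J F)" using F(1) finI finite_subset[of "J F" ?I] by blast
  ultimately have "lin_indep_family C ?u" using lin_indep_family_subset J F(1) by blast
  with C_dep show False ..
qed

text \<open>Lovasz's theorem on the intersections of flats with a generic hyperplane.\<close>

theorem dim_section_span_eq_Min:
  assumes fin: "finite P"
    and X: "open X" "n0 \<in> X"
    and nz: "\<And>e. e \<in> P \<Longrightarrow> D e n0 \<noteq> 0"
    and generic: "\<And>I n. I \<subseteq> P \<Longrightarrow> n \<in> X \<Longrightarrow> lin_indep_family I (\<lambda>e. section_vec e n)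
                    \<Longrightarrow> lin_indep_family I (\<lambda>e. section_vec e n0)"
  shows "Min {\<Sum>F\<in>\<P>. int (dim (flat_span F)) - 1 | \<P>. partition_on P \<P>}
    = int (dim (section_span n0 P))"
proof (rule Min_eqI)
  let ?u = "\<lambda>e. section_vec e n0"
  have "finite {\<P>. partition_on P \<P>}" using fin by (rule finitely_many_partition_on)
  then show "finite {\<Sum>F\<in>\<P>. int (dim (flat_span F)) - 1 | \<P>. partition_on P \<P>}"
    by (simp add: setcompr_eq_image)
  have Fe: "\<exists>e. e \<in> F \<and> D e n0 \<noteq> 0" if "partition_on P \<P>" "F \<in> \<P>" for \<P> F
  proof -
    have "F \<noteq> {}" "F \<subseteq> P" using that by (auto simp: partition_on_def)
    then show ?thesis using nz by blast
  qed
  \<comment> \<open>Every partition gives an upper bound, by subadditivity and the loss of one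
    dimension in each block. The rest of the proof exhibits a partition that attains it.\<close>
  have upper: "int (dim (section_span n0 P)) \<le> (\<Sum>F\<in>\<P>. int (dim (flat_span F)) - 1)"
    if \<P>: "partition_on P \<P>" for \<P>
  proof -
    have "finite \<P>" using \<P> fin finite_elements by blast
    then have "dim (section_span n0 P) \<le> (\<Sum>F\<in>\<P>. dim (section_span n0 F))"
      using dim_section_span_subadditive[of \<P> n0] \<P> by (simp add: partition_on_def)
    then have "int (dim (section_span n0 P)) \<le> (\<Sum>F\<in>\<P>. int (dim (section_span n0 F)))"
      by (metis of_nat_mono of_nat_sum)
    also have "\<dots> \<le> (\<Sum>F\<in>\<P>. int (dim (flat_span F)) - 1)"
      using Fe[OF \<P>] by (intro sum_mono) (use dim_section_span_le(1) in blast)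
    finally show ?thesis .
  qed
  then show "int (dim (section_span n0 P)) \<le> y"
    if "y \<in> {\<Sum>F\<in>\<P>. int (dim (flat_span F)) - 1 | \<P>. partition_on P \<P>}" for y
    using that by blast
  \<comment> \<open>By \<open>tight_Un\<close> this union is the largest tight set containing
    \<open>e\<close>; singletons are tight, so it is not empty.\<close>
  define cl where "cl e = \<Union>{F. F \<subseteq> P \<and> tight n0 F \<and> e \<in> F}" for e
  have cl_tight: "tight n0 (cl e)" and cl_self: "e \<in> cl e" if "e \<in> P" for e
  proof -
    have "finite {F. F \<subseteq> P \<and> tight n0 F \<and> e \<in> F}" using fin by simp
    moreover have *: "{e} \<in> {F. F \<subseteq> P \<and> tight n0 F \<and> e \<in> F}"
      using tight_singleton nz that by simp
    ultimately show "tight n0 (cl e)" "e \<in> cl e"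
      unfolding cl_def using tight_Union[of _ n0 e] nz[OF that] by blast+
  qed
  have cl_P: "cl e \<subseteq> P" for e by (auto simp: cl_def)
  \<comment> \<open>A tight set that meets \<open>cl e\<close> unites with it to a tight set
    containing \<open>e\<close>, so it is absorbed by maximality. This makes the sets
    \<open>cl e\<close> a partition and supplies the condition \<open>closed\<close>.\<close>
  have cl_sub: "C \<subseteq> cl e" if C: "C \<subseteq> P" "tight n0 C" "C \<inter> cl e \<noteq> {}" "e \<in> P" for C e
  proof -
    obtain f where f: "f \<in> C" "f \<in> cl e" using C(3) by blast
    then have "tight n0 (C \<union> cl e)"
      using tight_Un[OF C(2) cl_tight[OF C(4)]] nz C(1) by blast
    then have "C \<union> cl e \<in> {F. F \<subseteq> P \<and> tight n0 F \<and> e \<in> F}"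
      using C(1) cl_P cl_self[OF C(4)] by simp
    from Union_upper[OF this] show ?thesis by (simp only: cl_def[of e, symmetric]) simp
  qed
  define \<P> where "\<P> = cl ` P"
  have part: "partition_on P \<P>" unfolding partition_on_def \<P>_def
  proof (intro conjI)
    show "\<Union> (cl ` P) = P" using cl_P cl_self by blast
    show "disjoint (cl ` P)" unfolding disjoint_def
    proof (intro ballI impI)
      fix a b assume ab: "a \<in> cl ` P" "b \<in> cl ` P" "a \<noteq> b"
      then obtain e f where ef: "a = cl e" "b = cl f" "e \<in> P" "f \<in> P" by blast
      show "a \<inter> b = {}"
      proof (rule ccontr)
        assume "a \<inter> b \<noteq> {}"
        then have "a \<subseteq> b" "b \<subseteq> a"
          unfolding ef using cl_sub[OF cl_P cl_tight[OF ef(3)], of f] cl_sub[OF cl_P cl_tight[OF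
              ef(4)], of e] ef(3,4)
          by (simp_all add: Int_commute)
        with ab(3) show False by blast
      qed
    qed
    show "{} \<notin> cl ` P" using cl_self by blast
  qed
  have "\<exists>J. J \<subseteq> F \<and> lin_indep_family J ?u \<and> ?u ` F \<subseteq> span (?u ` J)" if "F \<in> \<P>" for F
  proof -
    have "finite F" using that cl_P fin finite_subset unfolding \<P>_def by blast
    then show ?thesis using lin_indep_family_basis[of F ?u] by metis
  qed
  then obtain J where J: "\<And>F. F \<in> \<P> \<Longrightarrow> J F \<subseteq> F \<and> lin_indep_family (J F) ?u"
    and J_span: "\<And>F. F \<in> \<P> \<Longrightarrow> ?u ` F \<subseteq> span (?u ` J F)" by metis
  have finF: "finite F" if "F \<in> \<P>" for F
    using that cl_P fin finite_subset unfolding \<P>_def by blast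
  have finJ: "finite (J F)" if "F \<in> \<P>" for F using J[OF that] finF[OF that] finite_subset by blast
  have fin\<P>: "finite \<P>" using fin by (simp add: \<P>_def)
  have ind: "lin_indep_family (\<Union>F\<in>\<P>. J F) ?u"
  proof (rule lin_indep_UN_tight_bases[OF fin part _ J X nz generic])
    show "C \<subseteq> F" if "C \<subseteq> P" "tight n0 C" "F \<in> \<P>" "C \<inter> F \<noteq> {}" for C F
      using that cl_sub unfolding \<P>_def by blast
  qed
  \<comment> \<open>Tightness turns the bound for each block into an equality, and independence of
    the union of the bases lets the ranks of the blocks add up.\<close>
  have "(\<Sum>F\<in>\<P>. int (dim (flat_span F)) - 1) = (\<Sum>F\<in>\<P>. int (card (J F)))"
  proof (rule sum.cong[OF refl])
    fix F assume F: "F \<in> \<P>"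
    have "?u ` J F \<subseteq> span (?u ` F)" using J[OF F] by (intro order_trans[OF _ span_superset]) blast
    then have "span (?u ` F) = span (?u ` J F)"
      using J_span[OF F] by (simp add: span_eq)
    then have "dim (section_span n0 F) = card (J F)"
      using lin_indep_family_dim[OF finJ[OF F] conjunct2[OF J[OF F]]]
      by (simp only: section_span_def)
    moreover have "tight n0 F" using F cl_tight unfolding \<P>_def by blast
    ultimately show "int (dim (flat_span F)) - 1 = int (card (J F))"
      using Fe[OF part F] dim_section_span_le(2) by metis
  qed
  also have "\<dots> = int (card (\<Union>F\<in>\<P>. J F))"
  proof -
    have "J F \<inter> J F' = {}" if "F \<in> \<P>" "F' \<in> \<P>" "F \<noteq> F'" for F F'
    proof -
      have "F \<inter> F' = {}" using part that by (auto simp: partition_on_def disjoint_def)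
      then show ?thesis using J[OF that(1)] J[OF that(2)] by blast
    qed
    then have "card (\<Union>F\<in>\<P>. J F) = (\<Sum>F\<in>\<P>. card (J F))"
      using fin\<P> finJ by (intro card_UN_disjoint) auto
    then show ?thesis by simp
  qed
  also have "\<dots> = int (dim (section_span n0 (\<Union>F\<in>\<P>. J F)))"
    unfolding section_span_def using lin_indep_family_dim[OF _ ind] fin\<P> finJ by simp
  also have "\<dots> \<le> int (dim (section_span n0 P))"
  proof -
    have "(\<Union>F\<in>\<P>. J F) \<subseteq> P" using J part by (fastforce simp: partition_on_def)
    then show ?thesis by (simp add: dim_subset section_span_mono)
  qed
  finally have le: "(\<Sum>F\<in>\<P>. int (dim (flat_span F)) - 1) \<le> int (dim (section_span n0 P))" .
  moreover have "int (dim (section_span n0 P)) \<le> (\<Sum>F\<in>\<P>. int (dim (flat_span F)) - 1)"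
    by (rule upper[OF part])
  ultimately have "int (dim (section_span n0 P)) = (\<Sum>F\<in>\<P>. int (dim (flat_span F)) - 1)"
    by simp
  then show "int (dim (section_span n0 P))
      \<in> {\<Sum>F\<in>\<P>. int (dim (flat_span F)) - 1 | \<P>. partition_on P \<P>}"
    using part by blast
qed

end

section \<open>Polynomials and genericity\<close>

lemma AE_lborel_real_polynomial_nonzero:
  fixes f :: "real \<Rightarrow> real"
  assumes "real_polynomial_function f" "f x0 \<noteq> 0"
  shows "AE x in lborel. f x \<noteq> 0"
proof -
  obtain a n where f: "f = (\<lambda>x. \<Sum>i\<le>n. a i * x ^ i)"
    using assms(1) unfolding real_polynomial_function_iff_sum by blast
  have "\<exists>i\<le>n. a i \<noteq> 0"
  proof (rule ccontr)
    assume "\<not> ?thesis"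
    then have "f x0 = 0" by (simp add: f)
    with assms(2) show False ..
  qed
  then have "finite {x. (\<Sum>i\<le>n. a i * x ^ i) = 0}" using polyfun_rootbound_finite by blast
  then have "emeasure lborel {x. f x = 0} = 0"
      by (simp add: f emeasure_lborel_countable countable_finite)
  moreover have "{x. f x = 0} \<in> sets lborel"
    using \<open>finite {x. (\<Sum>i\<le>n. a i * x ^ i) = 0}\<close> by (simp add: f countable_finite sets.countable)
  ultimately show ?thesis by (intro AE_I[of _ _ "{x. f x = 0}"]) auto
qed

text \<open>Fubini and induction on the coordinates. With the new coordinate frozen at its value in
  \<open>x0\<close>, the induction hypothesis covers almost all of the remaining ones; over each of
  these the fibre has a nonzero value, hence is nonzero almost everywhere. The coordinates may be
  vectors because the lemma serves both real coordinates and whole vertices.\<close>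

lemma AE_PiM_nonzero_if_coordinatewise:
  fixes g :: "('i \<Rightarrow> 'b::euclidean_space) \<Rightarrow> real"
  assumes "finite I" "g \<in> borel_measurable (Pi\<^sub>M I (\<lambda>_. lborel))"
    and "\<And>x i. i \<in> I \<Longrightarrow> \<exists>y. g (x(i := y)) \<noteq> 0 \<Longrightarrow> AE y in lborel. g (x(i := y)) \<noteq> 0"
    and "x0 \<in> extensional I" "g x0 \<noteq> 0"
  shows "AE x in Pi\<^sub>M I (\<lambda>_. lborel). g x \<noteq> 0"
  using assms
proof (induction I arbitrary: g x0 rule: finite_induct)
  case empty
  then have "x0 = (\<lambda>_. undefined)" by (auto simp: extensional_def)
  with empty.prems show ?case
    by (intro AE_I2) (auto simp: space_PiM PiE_def extensional_def)
next
  case (insert i I)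
  interpret product_sigma_finite "\<lambda>_::'i. lborel :: 'b measure"
    by standard
  have upd: "(\<lambda>(x, y). x(i := y))
      \<in> (Pi\<^sub>M I (\<lambda>_. lborel) \<Otimes>\<^sub>M (lborel :: 'b measure)) \<rightarrow>\<^sub>M Pi\<^sub>M (insert i I) (\<lambda>_. lborel)"
    using measurable_add_dim[of i I "\<lambda>_. lborel :: 'b measure"] by simp
  define h where "h x = g (x(i := x0 i))" for x
  have "h \<in> borel_measurable (Pi\<^sub>M I (\<lambda>_. lborel))"
  proof -
    have "(\<lambda>x. (x, x0 i)) \<in> Pi\<^sub>M I (\<lambda>_. lborel) \<rightarrow>\<^sub>M (Pi\<^sub>M I (\<lambda>_. lborel) \<Otimes>\<^sub>M (lborel :: 'b measure))"
      by simp
    from measurable_compose[OF measurable_compose[OF this upd] insert.prems(1)]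
    show ?thesis by (simp add: h_def[abs_def] fun_upd_def)
  qed
  moreover have "AE y in lborel. h (x(j := y)) \<noteq> 0"
    if "j \<in> I" "\<exists>y. h (x(j := y)) \<noteq> 0" for x j
  proof -
    have "j \<noteq> i" using that(1) insert.hyps(2) by blast
    then have eq: "x(j := y, i := x0 i) = x(i := x0 i, j := y)" for y by (rule fun_upd_twist)
    show ?thesis
      using insert.prems(2)[of j "x(i := x0 i)"] that(1) that(2)[unfolded h_def eq]
      unfolding h_def eq by blast
  qed
  \<comment> \<open>The product measure lives on extensional functions, so the witness for
    \<open>I\<close> must be \<open>undefined\<close> at the removed index.\<close>
  moreover have "x0(i := undefined) \<in> extensional I" "h (x0(i := undefined)) \<noteq> 0"
    using insert.prems(3,4) by (auto simp: extensional_def h_def)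
  ultimately have AE_h: "AE x in Pi\<^sub>M I (\<lambda>_. lborel). h x \<noteq> 0" by (rule insert.IH)
  have meas: "(\<lambda>x. if g x = 0 then 1 else 0 :: ennreal)
      \<in> borel_measurable (Pi\<^sub>M (insert i I) (\<lambda>_. lborel))"
    using insert.prems(1) by measurable
  have "(\<integral>\<^sup>+x. (if g x = 0 then 1 else 0) \<partial>Pi\<^sub>M (insert i I) (\<lambda>_. lborel))
      = (\<integral>\<^sup>+x. (\<integral>\<^sup>+y. (if g (x(i := y)) = 0 then 1 else 0) \<partial>lborel) \<partial>Pi\<^sub>M I (\<lambda>_. lborel))"
    by (rule product_nn_integral_insert[OF insert.hyps meas])
  also have "\<dots> = (\<integral>\<^sup>+x. 0 \<partial>Pi\<^sub>M I (\<lambda>_. lborel :: 'b measure))"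
  proof (rule nn_integral_cong_AE, rule AE_mp[OF AE_h], rule AE_I2, rule impI)
    fix x assume "h x \<noteq> 0"
    then have "AE y in lborel. g (x(i := y)) \<noteq> 0"
      unfolding h_def by (intro insert.prems(2) insertI1 exI[of _ "x0 i"])
    then have "(\<integral>\<^sup>+y. (if g (x(i := y)) = 0 then 1 else 0) \<partial>lborel)
        = (\<integral>\<^sup>+y. 0 \<partial>(lborel :: 'b measure))"
      by (intro nn_integral_cong_AE) auto
    then show "(\<integral>\<^sup>+y. (if g (x(i := y)) = 0 then 1 else 0) \<partial>lborel) = 0" by simp
  qed
  finally have "AE x in Pi\<^sub>M (insert i I) (\<lambda>_. lborel). (if g x = 0 then 1 else 0 :: ennreal) = 0"
    using nn_integral_0_iff_AE[OF meas] by simp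
  then show ?case by eventually_elim (auto split: if_splits)
qed

lemma borel_measurable_real_polynomial_function:
  fixes f :: "'a::euclidean_space \<Rightarrow> real"
  shows "real_polynomial_function f \<Longrightarrow> f \<in> borel_measurable borel"
  by (intro borel_measurable_continuous_onI)
    (simp add: continuous_on_eq_continuous_within continuous_at_imp_continuous_at_within
      continuous_real_polymonial_function)

text \<open>Lebesgue measure is the image under \<open>s\<close> of a product of real lines, and
  along each coordinate \<open>f\<close> is a polynomial in one variable.\<close>

lemma AE_lborel_polynomial_nonzero:
  fixes f :: "'a::euclidean_space \<Rightarrow> real"
  assumes f: "real_polynomial_function f" and x0: "f x0 \<noteq> 0"
  shows "AE x in lborel. f x \<noteq> 0"
proof -
  define s where "s = (\<lambda>c. \<Sum>b\<in>Basis. c b *\<^sub>R b :: 'a)"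
  have s_meas: "s \<in> (Pi\<^sub>M Basis (\<lambda>_. lborel)) \<rightarrow>\<^sub>M borel" unfolding s_def by measurable
  have f_meas: "f \<in> borel_measurable borel"
      using f by (rule borel_measurable_real_polynomial_function)
  have "AE c in Pi\<^sub>M Basis (\<lambda>_. lborel). f (s c) \<noteq> 0"
  proof (rule AE_PiM_nonzero_if_coordinatewise)
    show "(\<lambda>c. f (s c)) \<in> borel_measurable (Pi\<^sub>M Basis (\<lambda>_. lborel))"
      by (rule measurable_compose[OF s_meas f_meas])
    show "restrict (\<lambda>b. x0 \<bullet> b) Basis \<in> extensional Basis" by simp
    show "f (s (restrict (\<lambda>b. x0 \<bullet> b) Basis)) \<noteq> 0"
      using x0 by (simp add: s_def euclidean_representation)
  next
    fix c :: "'a \<Rightarrow> real" and i :: 'a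
    assume "i \<in> Basis" "\<exists>y. f (s (c(i := y))) \<noteq> 0"
    then obtain y where y: "f (s (c(i := y))) \<noteq> 0" by blast
    have "polynomial_function (\<lambda>y. s (c(i := y)))"
      unfolding s_def
    proof (intro polynomial_function_sum polynomial_function_mult finite_Basis
        polynomial_function_const)
      show "polynomial_function (\<lambda>y. (c(i := y)) b)" for b by (cases "b = i") simp_all
    qed
    from real_polynomial_function_compose[OF this f]
    show "AE y in lborel. f (s (c(i := y))) \<noteq> 0"
      by (intro AE_lborel_real_polynomial_nonzero[where ?x0.0 = y] y) (simp add: o_def)
  qed simp
  moreover have "{x \<in> space borel. f x \<noteq> 0} \<in> sets borel" using f_meas by measurable
  ultimately have "AE x in distr (Pi\<^sub>M Basis (\<lambda>_. lborel)) borel s. f x \<noteq> 0"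
    using AE_distr_iff[OF s_meas, of "\<lambda>x. f x \<noteq> 0"] by simp
  then show ?thesis using lborel_eq[where 'a='a] unfolding s_def by metis
qed

text \<open>Each vertex is now one coordinate, and moving it composes \<open>f\<close> with an
  affine map. The value 0 outside \<open>V\<close> is a mere default that extends a placement of
  \<open>V\<close> to a vector over the whole index type.\<close>

lemma AE_PiM_polynomial_nonzero:
  fixes f :: "'b::euclidean_space ^ 'v::finite \<Rightarrow> real" and V :: "'v set"
  assumes f: "real_polynomial_function f" and x0: "f (\<chi> v. if v \<in> V then x0 v else 0) \<noteq> 0"
  shows "AE x in Pi\<^sub>M V (\<lambda>_. lborel). f (\<chi> v. if v \<in> V then x v else 0) \<noteq> 0"
proof (rule AE_PiM_nonzero_if_coordinatewise)
  have "(\<lambda>x. (\<chi> v. if v \<in> V then x v else 0) :: 'b^'v) \<in> (Pi\<^sub>M V (\<lambda>_. lborel)) \<rightarrow>\<^sub>M borel"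
  proof (rule borel_measurable_euclidean_space[THEN iffD2], rule ballI)
    fix b :: "'b^'v" assume "b \<in> Basis"
    have "(\<lambda>x. if v \<in> V then x v else 0 :: 'b) \<in> (Pi\<^sub>M V (\<lambda>_. lborel)) \<rightarrow>\<^sub>M borel" for v
      by (cases "v \<in> V") (simp_all add: measurable_component_singleton[of v V
          "\<lambda>_. lborel", simplified])
    then show "(\<lambda>x. ((\<chi> v. if v \<in> V then x v else 0) :: 'b^'v) \<bullet> b) \<in> (Pi\<^sub>M V (\<lambda>_. lborel)) \<rightarrow>\<^sub>M borel"
      unfolding inner_vec_def vec_lambda_beta
          by (intro borel_measurable_sum borel_measurable_inner) auto
  qed
  from measurable_compose[OF this borel_measurable_real_polynomial_function[OF f]]
  show "(\<lambda>x. f (\<chi> v. if v \<in> V then x v else 0)) \<in> borel_measurable (Pi\<^sub>M V (\<lambda>_. lborel))" .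
next
  fix x :: "'v \<Rightarrow> 'b" and i :: 'v
  assume i: "i \<in> V" and "\<exists>y. f (\<chi> v. if v \<in> V then (x(i := y)) v else 0) \<noteq> 0"
  then obtain y where y: "f (\<chi> v. if v \<in> V then (x(i := y)) v else 0) \<noteq> 0" by blast
  have lin: "linear (\<lambda>y. axis i y :: 'b^'v)"
    by (rule linearI) (simp_all add: vec_eq_iff axis_def)
  have "polynomial_function (\<lambda>y. (\<chi> v. if v \<in> V \<and> v \<noteq> i then x v else 0) + (axis i y :: 'b^'v))"
    using lin
    by (intro polynomial_function_add polynomial_function_const polynomial_function_bounded_linear)
      (simp add: linear_conv_bounded_linear)
  moreover have "(\<chi> v. if v \<in> V then (x(i := y)) v else 0)
      = (\<chi> v. if v \<in> V \<and> v \<noteq> i then x v else 0) + (axis i y :: 'b^'v)" for y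
    using i by (simp add: vec_eq_iff axis_def)
  ultimately have "polynomial_function (\<lambda>y. (\<chi> v. if v \<in> V then (x(i := y)) v else 0) :: 'b^'v)"
    by simp
  from real_polynomial_function_compose[OF this f]
  show "AE y in lborel. f (\<chi> v. if v \<in> V then (x(i := y)) v else 0) \<noteq> 0"
    by (intro AE_lborel_polynomial_nonzero[where ?x0.0 = y] y) (simp add: o_def)
next
  show "restrict x0 V \<in> extensional V" by simp
  show "f (\<chi> v. if v \<in> V then (restrict x0 V) v else 0) \<noteq> 0"
    using x0 by (simp add: restrict_def cong: if_cong)
qed simp

section \<open>Linear independence as a polynomial condition\<close>

text \<open>One step of Gaussian elimination with pivot \<open>u j \<bullet> b\<close>. It is free
  of division, so vectors that depend polynomially on a parameter continue to do so.\<close>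

lemma lin_indep_family_insert_elimination:
  fixes u :: "'i \<Rightarrow> 'a::real_inner"
  assumes fin: "finite I" "j \<notin> I" and piv: "u j \<bullet> b \<noteq> 0"
  shows "lin_indep_family (insert j I) u
    \<longleftrightarrow> lin_indep_family I (\<lambda>i. (u j \<bullet> b) *\<^sub>R u i - (u i \<bullet> b) *\<^sub>R u j)" (is "?l \<longleftrightarrow> ?r")
proof -
  have w: "(\<Sum>i\<in>I. c i *\<^sub>R ((u j \<bullet> b) *\<^sub>R u i - (u i \<bullet> b) *\<^sub>R u j))
      = (u j \<bullet> b) *\<^sub>R (\<Sum>i\<in>I. c i *\<^sub>R u i) - ((\<Sum>i\<in>I. c i *\<^sub>R u i) \<bullet> b) *\<^sub>R u j" for c
    by (simp add: scaleR_diff_right sum_subtractf scaleR_sum_right scaleR_sum_left inner_sum_left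
        mult.commute)
  show ?thesis
  proof
    assume l: ?l
    show ?r unfolding lin_indep_family_def
    proof (intro allI impI ballI)
      fix c i assume c: "(\<Sum>i\<in>I. c i *\<^sub>R ((u j \<bullet> b) *\<^sub>R u i - (u i \<bullet> b) *\<^sub>R u j)) = 0" and i: "i \<in> I"
      define d where "d k = (if k = j then - ((\<Sum>i\<in>I. c i *\<^sub>R u i) \<bullet> b) else (u j \<bullet> b) * c k)" for k
      have "(\<Sum>k\<in>I. d k *\<^sub>R u k) = (u j \<bullet> b) *\<^sub>R (\<Sum>i\<in>I. c i *\<^sub>R u i)"
        unfolding scaleR_sum_right using fin(2) by (intro sum.cong) (auto simp: d_def)
      then have "(\<Sum>k\<in>insert j I. d k *\<^sub>R u k) = 0"
        using fin c unfolding w by (simp add: d_def)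
      from lin_indep_familyD[OF l this, of i] have "d i = 0" using i by simp
      then show "c i = 0" using i fin(2) piv by (auto simp: d_def split: if_splits)
    qed
  next
    assume r: ?r
    show ?l unfolding lin_indep_family_def
    proof (intro allI impI)
      fix c assume "(\<Sum>k\<in>insert j I. c k *\<^sub>R u k) = 0"
      then have s: "(\<Sum>i\<in>I. c i *\<^sub>R u i) = - (c j *\<^sub>R u j)"
        using fin by (simp add: eq_neg_iff_add_eq_0 add.commute)
      have "(\<Sum>i\<in>I. c i *\<^sub>R ((u j \<bullet> b) *\<^sub>R u i - (u i \<bullet> b) *\<^sub>R u j)) = 0"
        unfolding w s by simp
      then have I: "c i = 0" if "i \<in> I" for i using lin_indep_familyD[OF r _ that] by blast
      then have "c j *\<^sub>R u j = 0" using s by simp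
      moreover have "u j \<noteq> 0" using piv by auto
      ultimately show "\<forall>i\<in>insert j I. c i = 0" using I by simp
    qed
  qed
qed

text \<open>The polynomial is the product of the pivots met while eliminating at \<open>x0\<close>;
  it takes the place of a nonvanishing minor.\<close>

lemma polynomial_lin_indep_witness:
  fixes f :: "'i \<Rightarrow> 'b::real_normed_vector \<Rightarrow> 'a::euclidean_space"
  assumes "finite I" "\<And>i. i \<in> I \<Longrightarrow> polynomial_function (f i)" "lin_indep_family I (\<lambda>i. f i x0)"
  shows "\<exists>g. real_polynomial_function g \<and> g x0 \<noteq> 0 \<and>
    (\<forall>x. g x \<noteq> 0 \<longrightarrow> lin_indep_family I (\<lambda>i. f i x))"
  using assms
proof (induction I arbitrary: f rule: finite_induct)
  case empty
  show ?case
    by (rule exI[of _ "\<lambda>_. 1"])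
      (auto simp: lin_indep_family_def intro: real_polynomial_function.intros)
next
  case (insert j I)
  have "f j x0 \<noteq> 0"
  proof
    assume "f j x0 = 0"
    then have "(\<Sum>i\<in>insert j I. (if i = j then 1 else 0) *\<^sub>R f i x0) = 0"
      by (intro sum.neutral) auto
    from lin_indep_familyD[OF insert.prems(2) this, of j] show False by simp
  qed
  then obtain b where b: "b \<in> Basis" "f j x0 \<bullet> b \<noteq> 0" using euclidean_all_zero_iff by blast
  have inner_poly: "real_polynomial_function (\<lambda>x. f i x \<bullet> b)" if "i \<in> insert j I" for i
    using insert.prems(1)[OF that] b(1) by (simp add: polynomial_function_iff_Basis_inner)
  define w where "w i x = (f j x \<bullet> b) *\<^sub>R f i x - (f i x \<bullet> b) *\<^sub>R f j x" for i x
  have w_poly: "polynomial_function (w i)" if "i \<in> I" for i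
    unfolding w_def[abs_def] using that insert.prems(1) inner_poly
    by (intro polynomial_function_diff polynomial_function_mult)
      (auto simp: real_polynomial_function_eq[symmetric])
  have elim: "lin_indep_family (insert j I) (\<lambda>i. f i x) \<longleftrightarrow> lin_indep_family I (\<lambda>i. w i x)"
    if "f j x \<bullet> b \<noteq> 0" for x
    unfolding w_def by (rule lin_indep_family_insert_elimination[OF insert.hyps, of
        "\<lambda>i. f i x", OF that])
  obtain g where g: "real_polynomial_function g" "g x0 \<noteq> 0"
    "\<And>x. g x \<noteq> 0 \<Longrightarrow> lin_indep_family I (\<lambda>i. w i x)"
    using insert.IH[OF w_poly iffD1[OF elim[OF b(2)] insert.prems(2)]] by blast
  show ?case
  proof (intro exI[of _ "\<lambda>x. g x * (f j x \<bullet> b)"] conjI allI impI)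
    show "real_polynomial_function (\<lambda>x. g x * (f j x \<bullet> b))"
      using g(1) inner_poly by (intro real_polynomial_function.intros(4)) auto
    show "g x0 * (f j x0 \<bullet> b) \<noteq> 0" using g(2) b(2) by simp
    show "lin_indep_family (insert j I) (\<lambda>i. f i x)" if "g x * (f j x \<bullet> b) \<noteq> 0" for x
      using that g(3)[of x] elim[of x] by auto
  qed
qed

section \<open>Edge vectors of a gain graph\<close>

lemma matrix_vector_inner: "((A::real^'n^'m) *v x) \<bullet> y = x \<bullet> (transpose A *v y)"
  by (metis dot_lmul_matrix inner_commute transpose_matrix_vector)

lemma matrix_inv_mult:
  assumes "invertible (A::real^'n^'n)"
  shows "A ** matrix_inv A = mat 1" "matrix_inv A ** A = mat 1"
  using someI_ex[OF assms[unfolded invertible_def]] unfolding matrix_inv_def by auto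

lemma matrix_inv_orthogonal:
  assumes "orthogonal_matrix (A::real^'n^'n)"
  shows "matrix_inv A = transpose A"
proof -
  have A: "transpose A ** A = mat 1" "A ** transpose A = mat 1"
    using assms by (simp_all add: orthogonal_matrix_def)
  then have "invertible A" unfolding invertible_def by blast
  from matrix_inv_mult(1)[OF this] have "transpose A ** (A ** matrix_inv A) = transpose A" by simp
  then show ?thesis using A by (simp add: matrix_mul_assoc)
qed

lemma rot90_square: "rot90 ** rot90 = - mat 1"
  by (simp add: rot90_def matrix_matrix_mult_def mat_def vec_eq_iff forall_2 sum_2)

text \<open>A reflection would anticommute with \<open>rot90\<close>, so this is where the
  restriction to rotations enters.\<close>

lemma rot90_rotation_commute:
  assumes "rotation_matrix (A::real^2^2)"
  shows "rot90 ** A = A ** rot90"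
proof -
  have "transpose A ** A = mat 1" "A ** transpose A = mat 1" "det A = 1"
    using assms by (simp_all add: rotation_matrix_def orthogonal_matrix_def)
  then have e: "A$1$1 * A$1$1 + A$2$1 * A$2$1 = 1" "A$1$1 * A$1$2 + A$2$1 * A$2$2 = 0"
    "A$1$1 * A$2$2 - A$1$2 * A$2$1 = 1" "A$1$2 * A$1$2 + A$2$2 * A$2$2 = 1"
    by (simp_all add: matrix_matrix_mult_def transpose_def mat_def vec_eq_iff forall_2 sum_2 det_2)
  \<comment> \<open>The left side is the sum of the squared entries minus \<open>2 * det A\<close>,
    that is, 2 - 2.\<close>
  have "(A$1$1 - A$2$2)^2 + (A$1$2 + A$2$1)^2 = 0"
      using e by (simp add: power2_eq_square algebra_simps)
  then have "A$1$1 = A$2$2" "A$1$2 = - A$2$1" by (simp_all add: sum_power2_eq_zero_iff)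
  then show ?thesis
    by (simp add: rot90_def matrix_matrix_mult_def vec_eq_iff forall_2 sum_2)
qed

text \<open>For orthogonal \<open>A\<close> the transpose is the inverse in the definition of \<open>U\<close>; loops (\<open>i = j\<close>) and
  other edges get the same formula.\<close>

definition edge_vec :: "real^2^2 \<Rightarrow> ('k::finite \<Rightarrow> real^2^2) \<Rightarrow> 'w::finite \<Rightarrow> 'w \<Rightarrow> isom \<Rightarrow> real^2
    \<Rightarrow> ((real^2)^'w) \<times> (real^'k)" where
  "edge_vec B Bs i j \<phi> a = (axis i a - axis j (transpose (fst \<phi>) *v a), - bvec B Bs a (snd \<phi>))"

definition lat_comb :: "('k::finite \<Rightarrow> real^2^2) \<Rightarrow> real^'k \<Rightarrow> real^2^2" where
  "lat_comb Bs \<nu> = (\<Sum>l\<in>UNIV. \<nu> $ l *\<^sub>R Bs l)"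

text \<open>If the lattice part of \<open>n\<close> represents \<open>B\<close> itself, this is the
  usual difference between the first end of the edge and the transformed second end.\<close>

definition edge_adj :: "real^2^2 \<Rightarrow> ('k::finite \<Rightarrow> real^2^2) \<Rightarrow> 'w::finite \<Rightarrow> 'w \<Rightarrow> isom
    \<Rightarrow> ((real^2)^'w) \<times> (real^'k) \<Rightarrow> real^2" where
  "edge_adj B Bs i j \<phi> n =
     fst n $ i - fst \<phi> *v (fst n $ j) - (lat_comb Bs (snd n) ** matrix_inv B) *v snd \<phi>"

lemma linear_lat_comb: "linear (lat_comb Bs)"
  unfolding lat_comb_def
  by (rule linearI) (simp_all add: scaleR_add_left sum.distrib scaleR_sum_right)

lemma linear_edge_vec: "linear (edge_vec B Bs i j \<phi>)"
  unfolding edge_vec_def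
proof (rule linearI)
  show "(axis i (x + y) - axis j (transpose (fst \<phi>) *v (x + y)), - bvec B Bs (x + y) (snd \<phi>))
    = (axis i x - axis j (transpose (fst \<phi>) *v x), - bvec B Bs x (snd \<phi>))
      + (axis i y - axis j (transpose (fst \<phi>) *v y), - bvec B Bs y (snd \<phi>))" for x y
    by (simp add: vec_eq_iff axis_def bvec_def inner_add_left matrix_vector_right_distrib del:
        transpose_matrix_vector)
  show "(axis i (c *\<^sub>R x) - axis j (transpose (fst \<phi>) *v (c *\<^sub>R x)), - bvec B Bs (c *\<^sub>R x) (snd \<phi>))
    = c *\<^sub>R (axis i x - axis j (transpose (fst \<phi>) *v x), - bvec B Bs x (snd \<phi>))" for c x
    by (simp add: vec_eq_iff axis_def bvec_def matrix_vector_mult_scaleR scaleR_diff_right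
        right_diff_distrib
        del: transpose_matrix_vector)
qed

lemma scaleR_matrix_vector: "(c *\<^sub>R (A::real^'n^'m)) *v x = c *\<^sub>R (A *v x)"
  by (rule scaleR_matrix_vector_assoc[symmetric])

lemma scaleR_matrix_matrix: "(c *\<^sub>R (A::real^'n^'m)) ** (M::real^'p^'n) = c *\<^sub>R (A ** M)"
  by (rule scalar_matrix_assoc[symmetric])

lemma matrix_add_rdistrib: "((A::real^'n^'m) + B) ** (C::real^'p^'n) = A ** C + B ** C"
  by (simp add: matrix_matrix_mult_def vec_eq_iff distrib_right sum.distrib)

lemma matrix_minus_mult: "(- (A::real^'n^'m)) ** (M::real^'p^'n) = - (A ** M)"
  by (simp add: matrix_matrix_mult_def vec_eq_iff sum_negf)

lemma matrix_mult_minus: "(A::real^'n^'m) ** (- (M::real^'p^'n)) = - (A ** M)"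
  by (simp add: matrix_matrix_mult_def vec_eq_iff sum_negf)

lemma linear_edge_adj: "linear (edge_adj B Bs i j \<phi>)"
proof (rule linearI)
  show "edge_adj B Bs i j \<phi> (x + y) = edge_adj B Bs i j \<phi> x + edge_adj B Bs i j \<phi> y" for x y
    by (simp add: edge_adj_def linear_add[OF linear_lat_comb] matrix_vector_right_distrib
        matrix_add_rdistrib matrix_vector_mult_add_rdistrib)
  show "edge_adj B Bs i j \<phi> (c *\<^sub>R x) = c *\<^sub>R edge_adj B Bs i j \<phi> x" for c x
    by (simp add: edge_adj_def linear_cmul[OF linear_lat_comb] matrix_vector_mult_scaleR
        scaleR_matrix_matrix scaleR_matrix_vector scaleR_diff_right)
qed

lemma sum_matrix_mult: "(\<Sum>l\<in>S. (M l :: real^'n^'m)) ** (A::real^'p^'n) = (\<Sum>l\<in>S. M l ** A)"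
  by (induction S rule: infinite_finite_induct) (simp_all add: matrix_add_rdistrib)

lemma sum_matrix_vector: "(\<Sum>l\<in>S. (M l :: real^'n^'m)) *v x = (\<Sum>l\<in>S. M l *v x)"
  by (induction S rule: infinite_finite_induct) (simp_all add: matrix_vector_mult_add_rdistrib)

lemma inner_lat_comb:
  "a \<bullet> ((lat_comb Bs \<nu> ** M) *v t) = (\<Sum>l\<in>UNIV. (a \<bullet> ((Bs l ** M) *v t)) * \<nu> $ l)"
  by (simp add: lat_comb_def sum_matrix_mult sum_matrix_vector scaleR_matrix_matrix
      scaleR_matrix_vector inner_sum_right mult.commute)

lemma edge_vec_inner: "edge_vec B Bs i j \<phi> a \<bullet> n = a \<bullet> edge_adj B Bs i j \<phi> n"
proof -
  have "bvec B Bs a (snd \<phi>) \<bullet> snd n = a \<bullet> ((lat_comb Bs (snd n) ** matrix_inv B) *v snd \<phi>)"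
    unfolding inner_lat_comb by (simp add: bvec_def inner_vec_def)
  then show ?thesis
    by (simp add: edge_vec_def edge_adj_def inner_prod_def inner_diff_left inner_diff_right
        inner_axis' matrix_vector_inner del: transpose_matrix_vector)
qed

abbreviation graph_vec where
  "graph_vec B Bs G \<equiv> \<lambda>e. edge_vec B Bs (src G e) (tgt G e) (gain G e)"

abbreviation graph_adj where
  "graph_adj B Bs G \<equiv> \<lambda>e. edge_adj B Bs (src G e) (tgt G e) (gain G e)"

lemma planar_sections_graph: "planar_sections (graph_vec B Bs G) (graph_adj B Bs G)"
  by (rule planar_sections.intro) (rule linear_edge_vec linear_edge_adj edge_vec_inner)+

lemma loop_vec_eq_edge_vec:
  assumes "orthogonal_matrix (fst \<phi>)"
  shows "loop_vec B Bs i \<phi> a = edge_vec B Bs i i \<phi> a"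
  unfolding loop_vec_def edge_vec_def matrix_inv_orthogonal[OF assms]
  by (simp add: vec_eq_iff axis_def matrix_vector_mult_diff_rdistrib del: transpose_matrix_vector)

lemma orthogonal_matrix_vector_cancel:
  assumes "orthogonal_matrix (A::real^'n^'n)"
  shows "A *v (transpose A *v x) = x" "transpose A *v (A *v x) = x"
  using assms by (simp_all only: orthogonal_matrix_def matrix_vector_mul_assoc
      matrix_vector_mul_lid)

lemma nonloop_vec:
  assumes "orthogonal_matrix (fst \<phi>)" "i \<noteq> j"
  shows "x $ i + fst \<phi> *v (x $ j) = 0 \<and> bvec B Bs (x $ i) (snd \<phi>) + y = 0 \<and>
      (\<forall>w. w \<noteq> i \<and> w \<noteq> j \<longrightarrow> x $ w = 0) \<longleftrightarrow> (x, y) = edge_vec B Bs i j \<phi> (x $ i)"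
proof -
  note cancel = orthogonal_matrix_vector_cancel[OF assms(1)]
  have neg: "A *v (- v) = - (A *v v)" for A :: "real^2^2" and v
    by (rule linear_neg[OF matrix_vector_mul_linear])
  have "x $ i + fst \<phi> *v (x $ j) = 0 \<longleftrightarrow> x $ j = - (transpose (fst \<phi>) *v (x $ i))"
  proof
    assume "x $ i + fst \<phi> *v (x $ j) = 0"
    then have "x $ i = fst \<phi> *v (- x $ j)" by (simp add: neg add_eq_0_iff2)
    then show "x $ j = - (transpose (fst \<phi>) *v (x $ i))" by (simp only: cancel minus_minus)
  next
    assume "x $ j = - (transpose (fst \<phi>) *v (x $ i))"
    then show "x $ i + fst \<phi> *v (x $ j) = 0" by (simp only: neg cancel right_minus)
  qed
  moreover have "(x, y) = edge_vec B Bs i j \<phi> (x $ i) \<longleftrightarrow>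
      x $ j = - (transpose (fst \<phi>) *v (x $ i)) \<and> (\<forall>w. w \<noteq> i \<and> w \<noteq> j \<longrightarrow> x $ w = 0)
      \<and> y = - bvec B Bs (x $ i) (snd \<phi>)"
    using assms(2)
    by (auto simp: edge_vec_def vec_eq_iff[of x] axis_def simp del: transpose_matrix_vector)
  ultimately show ?thesis
    by (simp only: add_eq_0_iff) blast
qed

lemma U_eq_range:
  assumes "orthogonal_matrix (fst (gain G e))"
  shows "U B Bs G e = range (graph_vec B Bs G e)"
proof (cases "src G e = tgt G e")
  case True
  then show ?thesis
    by (simp add: U_def Let_def loop_vec_eq_edge_vec[OF assms] full_SetCompr_eq)
next
  case False
  have src: "fst (edge_vec B Bs (src G e) (tgt G e) (gain G e) a) $ src G e = a" for a
    using False by (simp add: edge_vec_def axis_def)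
  have eq: "(x, y) \<in> range (graph_vec B Bs G e) \<longleftrightarrow> (x, y) = graph_vec B Bs G e (x $ src G e)"
    for x y
  proof
    assume "(x, y) \<in> range (graph_vec B Bs G e)"
    then obtain a where a: "(x, y) = graph_vec B Bs G e a" by blast
    have "x $ src G e = a" using src[of a] unfolding a[symmetric] by simp
    then show "(x, y) = graph_vec B Bs G e (x $ src G e)" using a by simp
  qed (rule range_eqI)
  show ?thesis
    unfolding U_def Let_def if_P[OF False] nonloop_vec[OF assms False] eq[symmetric] by simp
qed

text \<open>For a non-loop edge the coordinate at the source is the parameter, so a condition on
  that coordinate becomes a condition on the parameter, as loops have it by definition.\<close>

lemma range_Int_component_condition:
  assumes "\<And>a. fst (f a) $ s = a"
  shows "range f \<inter> {(x, y). P (x $ s)} = f ` {a. P a}"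
proof (rule Set.set_eqI)
  fix z
  have "z \<in> range f \<inter> {(x, y). P (x $ s)} \<longleftrightarrow> (\<exists>a. z = f a \<and> P (fst z $ s))"
    by (cases z) auto
  also have "\<dots> \<longleftrightarrow> (\<exists>a. z = f a \<and> P a)"
    by (intro ex_cong1 conj_cong refl) (simp add: assms)
  also have "\<dots> \<longleftrightarrow> z \<in> f ` {a. P a}" by blast
  finally show "z \<in> range f \<inter> {(x, y). P (x $ s)} \<longleftrightarrow> z \<in> f ` {a. P a}" .
qed

lemma R'_eq_image:
  fixes G :: "('w::finite, 'e) gain_graph"
  assumes "orthogonal_matrix (fst (gain G e))"
  shows "R' B Bs G p e = graph_vec B Bs G e `
    {a. (rot90 *v (p (src G e) - (fst (gain G e) *v p (tgt G e) + snd (gain G e)))) \<bullet> a = 0}"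
proof (cases "src G e = tgt G e")
  case True
  then show ?thesis
    by (simp add: R'_def Let_def loop_vec_eq_edge_vec[OF assms] setcompr_eq_image)
next
  case False
  have "fst (edge_vec B Bs (src G e) (tgt G e) (gain G e) a) $ src G e = a" for a
    using False by (simp add: edge_vec_def axis_def)
  then show ?thesis
    unfolding R'_def Let_def U_eq_range[OF assms] if_P[OF False]
    by (rule range_Int_component_condition)
qed

section \<open>The commutant of the linear part and the transfer between lattices\<close>

locale rotation_lattice =
  fixes \<Gamma> :: "isom set" and B :: "real^2^2" and Bs :: "'k::finite \<Rightarrow> real^2^2"
  assumes subgroup: "subgroup \<Gamma> euclid"
    and rotation: "\<gamma> \<in> \<Gamma> \<Longrightarrow> rotation_matrix (fst \<gamma>)"
    and B_invertible: "invertible B"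
    and basis: "Lat_basis \<Gamma> B Bs"
begin

definition commuting :: "real^2^2 \<Rightarrow> bool" where
  "commuting Z \<longleftrightarrow> (\<forall>\<gamma>\<in>\<Gamma>. Z ** fst \<gamma> = fst \<gamma> ** Z)"

lemma orthogonal: "\<gamma> \<in> \<Gamma> \<Longrightarrow> orthogonal_matrix (fst \<gamma>)"
  using rotation by (simp add: rotation_matrix_def)

lemma B_inv [simp]: "B ** matrix_inv B = mat 1" "matrix_inv B ** B = mat 1"
  using matrix_inv_mult[OF B_invertible] by auto

lemma B_inv_assoc [simp]: "M ** B ** matrix_inv B = M" "M ** matrix_inv B ** B = M"
    for M :: "real^2^2"
  by (simp_all add: matrix_mul_assoc[symmetric])

text \<open>\<open>Kmat B \<gamma>\<close> is the conjugate of the linear part by \<open>B\<close>,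
  so cancelling \<open>B\<close> turns the lattice space into the commutant of the linear part. As
  the commutant is closed under products, it acts on the lattice space from the left.\<close>

lemma Lat_iff_commuting: "M \<in> Lat \<Gamma> B \<longleftrightarrow> commuting (M ** matrix_inv B)"
proof -
  have "M ** Kmat B \<gamma> = fst \<gamma> ** M
      \<longleftrightarrow> (M ** matrix_inv B) ** fst \<gamma> = fst \<gamma> ** (M ** matrix_inv B)" for \<gamma>
  proof
    assume "M ** Kmat B \<gamma> = fst \<gamma> ** M"
    then have "M ** Kmat B \<gamma> ** matrix_inv B = fst \<gamma> ** M ** matrix_inv B" by simp
    then show "(M ** matrix_inv B) ** fst \<gamma> = fst \<gamma> ** (M ** matrix_inv B)"
      by (simp add: Kmat_def matrix_mul_assoc)
  next
    assume "(M ** matrix_inv B) ** fst \<gamma> = fst \<gamma> ** (M ** matrix_inv B)"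
    then have "M ** matrix_inv B ** fst \<gamma> ** B = fst \<gamma> ** M ** matrix_inv B ** B"
      by (simp add: matrix_mul_assoc)
    then show "M ** Kmat B \<gamma> = fst \<gamma> ** M" by (simp add: Kmat_def matrix_mul_assoc)
  qed
  then show ?thesis by (simp add: Lat_def commuting_def)
qed

lemma commuting_mult: "commuting Y \<Longrightarrow> commuting Z \<Longrightarrow> commuting (Y ** Z)"
  unfolding commuting_def by (metis matrix_mul_assoc)

lemma commuting_rot90: "commuting rot90"
  unfolding commuting_def using rot90_rotation_commute rotation by blast

lemma commuting_uminus: "commuting Z \<Longrightarrow> commuting (- Z)"
  unfolding commuting_def by (simp add: matrix_minus_mult matrix_mult_minus)

lemma transpose_linear_part: "\<gamma> \<in> \<Gamma> \<Longrightarrow> \<exists>\<delta>\<in>\<Gamma>. fst \<delta> = transpose (fst \<gamma>)"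
proof -
  assume g: "\<gamma> \<in> \<Gamma>"
  interpret group euclid by (rule group_euclid)
  have inv: "inv\<^bsub>euclid\<^esub> \<gamma> \<in> \<Gamma>" using subgroup.m_inv_closed[OF subgroup g] .
  have "inv\<^bsub>euclid\<^esub> \<gamma> \<otimes>\<^bsub>euclid\<^esub> \<gamma> = \<one>\<^bsub>euclid\<^esub>"
    using subgroup.mem_carrier[OF subgroup g] by simp
  then have e: "fst (inv\<^bsub>euclid\<^esub> \<gamma>) ** fst \<gamma> = mat 1"
    by (simp add: euclid_def case_prod_beta prod_eq_iff)
  have "fst \<gamma> ** transpose (fst \<gamma>) = mat 1"
      using orthogonal[OF g] by (simp add: orthogonal_matrix_def)
  then have "fst (inv\<^bsub>euclid\<^esub> \<gamma>) = (fst (inv\<^bsub>euclid\<^esub> \<gamma>) ** fst \<gamma>) ** transpose (fst \<gamma>)"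
    by (simp add: matrix_mul_assoc[symmetric])
  then show ?thesis using e inv by auto
qed

lemma commuting_transpose_part:
  assumes "commuting Z" "\<gamma> \<in> \<Gamma>"
  shows "Z ** transpose (fst \<gamma>) = transpose (fst \<gamma>) ** Z"
  using transpose_linear_part[OF assms(2)] assms(1) unfolding commuting_def by metis

text \<open>The linear part is closed under transposition, being a group of orthogonal matrices.
  Transposes appear when \<open>Z\<close> is moved across an inner product in
  \<open>bvec\<close>.\<close>

lemma commuting_transpose:
  assumes "commuting Z"
  shows "commuting (transpose Z)"
  unfolding commuting_def
proof
  fix \<gamma> assume "\<gamma> \<in> \<Gamma>"
  from commuting_transpose_part[OF assms this]
  have "transpose (Z ** transpose (fst \<gamma>)) = transpose (transpose (fst \<gamma>) ** Z)" by simp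
  then show "transpose Z ** fst \<gamma> = fst \<gamma> ** transpose Z" by (simp add: matrix_transpose_mul)
qed

lemma Lat_eq_range: "Lat \<Gamma> B = range (lat_comb Bs)"
proof -
  have inj: "inj Bs" and sp: "span (range Bs) = Lat \<Gamma> B" using basis by (auto simp: Lat_basis_def)
  have "span (range Bs) = range (\<lambda>u. \<Sum>v\<in>range Bs. u v *\<^sub>R v)" by (rule span_finite) simp
  also have "\<dots> = range (lat_comb Bs)"
  proof (intro equalityI subsetI)
    fix x assume "x \<in> range (\<lambda>u. \<Sum>v\<in>range Bs. u v *\<^sub>R v)"
    then obtain u where "x = (\<Sum>v\<in>range Bs. u v *\<^sub>R v)" by blast
    then have "x = lat_comb Bs (\<chi> l. u (Bs l))" by (simp add: lat_comb_def sum.reindex[OF inj])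
    then show "x \<in> range (lat_comb Bs)" by blast
  next
    fix x assume "x \<in> range (lat_comb Bs)"
    then obtain \<nu> where "x = lat_comb Bs \<nu>" by blast
    then have "x = (\<Sum>v\<in>range Bs. (\<nu> $ inv_into UNIV Bs v) *\<^sub>R v)"
      by (simp add: lat_comb_def sum.reindex[OF inj] inv_f_f[OF inj])
    then show "x \<in> range (\<lambda>u. \<Sum>v\<in>range Bs. u v *\<^sub>R v)"
      by (rule range_eqI[of _ _ "\<lambda>v. \<nu> $ inv_into UNIV Bs v"])
  qed
  finally show ?thesis using sp by simp
qed

lemma commuting_mult_Lat:
  assumes "commuting Z" "M \<in> Lat \<Gamma> B"
  shows "Z ** M \<in> Lat \<Gamma> B"
  using commuting_mult[OF assms(1), of "M ** matrix_inv B"] assms(2)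
  by (simp add: Lat_iff_commuting matrix_mul_assoc)

lemma lat_comb_axis: "lat_comb Bs (axis l 1) = Bs l"
  unfolding lat_comb_def axis_def by (subst sum.remove[of _ l]) (auto intro!: sum.neutral)

lemma Bs_Lat: "Bs l \<in> Lat \<Gamma> B"
  unfolding Lat_eq_range by (metis lat_comb_axis rangeI)

text \<open>Each \<open>Bs l ** matrix_inv B\<close> lies in the commutant, so the linear part can
  be moved from one argument of \<open>bvec\<close> to the other.\<close>

lemma bvec_transpose:
  assumes "\<gamma> \<in> \<Gamma>"
  shows "bvec B Bs (transpose (fst \<gamma>) *v a) t = bvec B Bs a (fst \<gamma> *v t)"
proof -
  have "Bs l ** matrix_inv B ** fst \<gamma> = fst \<gamma> ** (Bs l ** matrix_inv B)" for l
    using Bs_Lat[of l] assms by (simp add: Lat_iff_commuting commuting_def)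
  then have "(Bs l ** matrix_inv B) *v (fst \<gamma> *v t) = fst \<gamma> *v ((Bs l ** matrix_inv B) *v t)" for l
    by (simp only: matrix_vector_mul_assoc)
  then show ?thesis
    by (simp add: bvec_def matrix_vector_inner[of "transpose (fst \<gamma>)"] del: transpose_matrix_vector)
qed

text \<open>The point is that one map \<open>M\<close> serves all edges and gains, so it carries
  linear relations among edge vectors along.\<close>

lemma edge_vec_commuting:
  assumes Z: "commuting Z"
  obtains M where "linear M"
    "\<And>i j \<phi> a. \<phi> \<in> \<Gamma> \<Longrightarrow> edge_vec B Bs i j \<phi> (Z *v a)
        = M (edge_vec B Bs i j \<phi> a :: ((real^2)^'w::finite) \<times> (real^'k))"
proof -
  \<comment> \<open>On the lattice coordinates \<open>M\<close> is given by the action of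
    \<open>transpose Z\<close> on the basis \<open>Bs\<close>.\<close>
  have "\<exists>c. transpose Z ** Bs l = lat_comb Bs c" for l
    using commuting_mult_Lat[OF commuting_transpose[OF Z] Bs_Lat] unfolding Lat_eq_range by blast
  then obtain c where c: "\<And>l. transpose Z ** Bs l = lat_comb Bs (c l)" by metis
  define M :: "((real^2)^'w) \<times> (real^'k) \<Rightarrow> ((real^2)^'w) \<times> (real^'k)"
    where "M n = (\<chi> w. Z *v (fst n $ w), \<chi> l. \<Sum>m\<in>UNIV. snd n $ m * c l $ m)" for n
  have "linear M"
    by (rule linearI) (simp_all add: M_def vec_eq_iff matrix_vector_right_distrib
        matrix_vector_mult_scaleR distrib_right sum.distrib sum_distrib_left mult.assoc)
  moreover have "edge_vec B Bs i j \<phi> (Z *v a) = M (edge_vec B Bs i j \<phi> a)" if "\<phi> \<in> \<Gamma>"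
      for i j :: 'w and \<phi> a
  proof -
    have 1: "transpose (fst \<phi>) *v (Z *v a) = Z *v (transpose (fst \<phi>) *v a)"
      by (simp only: matrix_vector_mul_assoc commuting_transpose_part[OF Z that])
    have 2: "bvec B Bs (Z *v a) t $ l = (\<Sum>m\<in>UNIV. bvec B Bs a t $ m * c l $ m)" for t l
    proof -
      have "(Z *v a) \<bullet> ((Bs l ** matrix_inv B) *v t)
          = a \<bullet> ((lat_comb Bs (c l) ** matrix_inv B) *v t)"
        by (simp only: matrix_vector_inner matrix_vector_mul_assoc matrix_mul_assoc c)
      then show ?thesis unfolding inner_lat_comb by (simp add: bvec_def)
    qed
    have "M (edge_vec B Bs i j \<phi> a)
        = (axis i (Z *v a) - axis j (transpose (fst \<phi>) *v (Z *v a)), - bvec B Bs (Z *v a) (snd \<phi>))"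
      unfolding 1
      by (simp add: M_def edge_vec_def vec_eq_iff 2 sum_negf axis_def
          matrix_vector_mult_diff_distrib
          del: transpose_matrix_vector)
    then show ?thesis by (simp add: edge_vec_def)
  qed
  ultimately show thesis by (rule that)
qed

lemma edge_adj_commuting:
  assumes "commuting Z" "\<phi> \<in> \<Gamma>" "lat_comb Bs \<nu>' = Z ** lat_comb Bs \<nu>"
  shows "edge_adj B Bs i j \<phi> (\<chi> w. Z *v (x $ w), \<nu>') = Z *v edge_adj B Bs i j \<phi> (x, \<nu>)"
proof -
  have "fst \<phi> *v (Z *v (x $ j)) = Z *v (fst \<phi> *v (x $ j))"
    using assms(1,2) by (simp add: matrix_vector_mul_assoc commuting_def)
  then show ?thesis
    using assms(3)
    by (simp add: edge_adj_def matrix_vector_mult_diff_distrib matrix_vector_mul_assoc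
        matrix_mul_assoc)
qed

text \<open>The normal vector that realises \<open>p\<close>: the signs turn the rotation in the section vectors back, so that
  the section of \<open>U\<close> is spanned by the direction \<open>p i - (A p j + t)\<close>.\<close>

definition placement :: "('w::finite \<Rightarrow> real^2) \<Rightarrow> ((real^2)^'w) \<times> (real^'k)" where
  "placement p = (\<chi> w. - (rot90 *v p w), SOME \<nu>. lat_comb Bs \<nu> = - (rot90 ** B))"

text \<open>The choice in \<open>placement\<close> is legitimate because
  \<open>- (rot90 ** B)\<close> corresponds to \<open>- rot90\<close>, which commutes with
  rotations.\<close>

lemma lat_comb_placement: "lat_comb Bs (snd (placement p)) = - (rot90 ** B)"
proof -
  have "- (rot90 ** B) \<in> Lat \<Gamma> B"
    using commuting_uminus[OF commuting_rot90]
    by (simp add: Lat_iff_commuting matrix_minus_mult)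
  then obtain \<nu> where "lat_comb Bs \<nu> = - (rot90 ** B)" unfolding Lat_eq_range by (metis rangeE)
  then show ?thesis unfolding placement_def snd_conv by (rule someI)
qed

lemma edge_adj_placement:
  assumes "\<phi> \<in> \<Gamma>"
  shows "rot90 *v edge_adj B Bs i j \<phi> (placement p) = p i - (fst \<phi> *v p j + snd \<phi>)"
proof -
  have r: "rot90 *v (- (rot90 *v v)) = v" for v
    by (simp add: vec_eq_iff forall_2)
  have c: "fst \<phi> *v (- (rot90 *v v)) = - (rot90 *v (fst \<phi> *v v))" for v
  proof -
    have "fst \<phi> *v (rot90 *v v) = rot90 *v (fst \<phi> *v v)"
      using commuting_rot90 assms unfolding commuting_def by (simp only: matrix_vector_mul_assoc)
    then show ?thesis by (simp add: linear_neg[OF matrix_vector_mul_linear])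
  qed
  have m: "(- (rot90 ** B) ** matrix_inv B) *v v = - (rot90 *v v)" for v
    by (simp add: matrix_minus_mult) (simp add: vec_eq_iff matrix_vector_mult_def sum_negf)
  have "edge_adj B Bs i j \<phi> (placement p)
      = - (rot90 *v p i) + rot90 *v (fst \<phi> *v p j) + rot90 *v snd \<phi>"
    unfolding edge_adj_def lat_comb_placement m by (simp add: placement_def c)
  also have "\<dots> = - (rot90 *v (p i - (fst \<phi> *v p j + snd \<phi>)))"
    by (simp add: matrix_vector_mult_diff_distrib matrix_vector_right_distrib)
  finally show ?thesis by (simp only: r)
qed

lemma placement_surj: "\<exists>p. fst (placement p) = x"
  by (intro exI[of _ "\<lambda>w. rot90 *v (x $ w)"])
    (simp add: placement_def vec_eq_iff forall_2)

text \<open>Independence is pulled back from \<open>n\<close> to a placement \<open>m\<close> with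
  \<open>n = Z m\<close>: the map \<open>M\<close> carries the section vectors at \<open>m\<close>
  to those at \<open>n\<close>, so a relation at \<open>m\<close> is also one at \<open>n\<close>.
  Invertibility of the lattice part is what allows solving for the vertex part of
  \<open>m\<close>.\<close>

lemma lin_indep_placement:
  fixes G :: "('w::finite, 'e) gain_graph" and n :: "((real^2)^'w) \<times> (real^'k)"
  assumes gains: "\<And>e. e \<in> I \<Longrightarrow> gain G e \<in> \<Gamma>"
    and inv: "invertible (lat_comb Bs (snd n))"
    and ind: "lin_indep_family I (\<lambda>e. graph_vec B Bs G e (rot90 *v graph_adj B Bs G e n))"
  obtains p where "lin_indep_family I
      (\<lambda>e. graph_vec B Bs G e (rot90 *v graph_adj B Bs G e (placement p)))"
proof -
  let ?N = "lat_comb Bs (snd n)"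
  define Y where "Y = ?N ** matrix_inv B"
  define Z where "Z = Y ** rot90"
  have N_Lat: "?N \<in> Lat \<Gamma> B" unfolding Lat_eq_range by blast
  then have Y: "commuting Y" by (simp add: Lat_iff_commuting Y_def)
  have Z: "commuting Z" unfolding Z_def by (rule commuting_mult[OF Y commuting_rot90])
  \<comment> \<open>The inverse of \<open>Z\<close>, with the inverse of \<open>rot90\<close>
    written as \<open>- rot90\<close>.\<close>
  define Zi where "Zi = - (rot90 ** (B ** matrix_inv ?N))"
  have "Z ** Zi = mat 1"
  proof -
    have "Z ** Zi = - (Y ** (rot90 ** rot90) ** (B ** matrix_inv ?N))"
      by (simp add: Z_def Zi_def matrix_mult_minus matrix_mul_assoc)
    also have "\<dots> = ?N ** matrix_inv B ** B ** matrix_inv ?N"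
      by (simp add: rot90_square matrix_mult_minus matrix_minus_mult Y_def matrix_mul_assoc)
    finally show ?thesis by (simp add: matrix_inv_mult[OF inv])
  qed
  then have ZZi: "Z *v (Zi *v v) = v" for v by (simp add: matrix_vector_mul_assoc)
  obtain p where p: "fst (placement p) = (\<chi> w. Zi *v (fst n $ w))" using placement_surj by blast
  define m where "m = placement p"
  have n: "n = (\<chi> w. Z *v (fst m $ w), snd n)" by (simp add: m_def p ZZi prod_eq_iff vec_eq_iff)
  have lat: "lat_comb Bs (snd n) = Z ** lat_comb Bs (snd m)"
  proof -
    have "Z ** lat_comb Bs (snd m) = - (Y ** (rot90 ** rot90) ** B)"
      by (simp add: m_def lat_comb_placement Z_def matrix_mult_minus matrix_mul_assoc)
    then show ?thesis by (simp add: rot90_square matrix_mult_minus matrix_minus_mult Y_def)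
  qed
  have adj: "edge_adj B Bs i j \<phi> n = Z *v edge_adj B Bs i j \<phi> m" if "\<phi> \<in> \<Gamma>" for i j \<phi>
    using edge_adj_commuting[OF Z that lat, of i j "fst m"] n by simp
  \<comment> \<open>Chosen so that \<open>rot90 ** Z = W ** rot90\<close>: section vectors contain a
    quarter turn after \<open>D\<close>, and \<open>Z\<close> has to be moved past it.\<close>
  define W where "W = rot90 ** Y"
  have "commuting W" unfolding W_def by (rule commuting_mult[OF commuting_rot90 Y])
  then obtain M where M: "linear M" "\<And>i j \<phi> a. \<phi> \<in> \<Gamma> \<Longrightarrow> edge_vec B Bs i j \<phi> (W *v a)
      = M (edge_vec B Bs i j \<phi> a :: ((real^2)^'w) \<times> (real^'k))"
    by (rule edge_vec_commuting) blast
  have v: "graph_vec B Bs G e (rot90 *v graph_adj B Bs G e n)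
      = M (graph_vec B Bs G e (rot90 *v graph_adj B Bs G e m))" if "e \<in> I" for e
  proof -
    have "rot90 *v (Z *v a) = W *v (rot90 *v a)" for a
      by (simp add: W_def Z_def matrix_vector_mul_assoc matrix_mul_assoc)
    then show ?thesis using gains[OF that] by (simp add: adj M(2))
  qed
  have "lin_indep_family I (\<lambda>e. graph_vec B Bs G e (rot90 *v graph_adj B Bs G e m))"
    unfolding lin_indep_family_def
  proof (intro allI impI)
    fix c assume c: "(\<Sum>e\<in>I. c e *\<^sub>R graph_vec B Bs G e (rot90 *v graph_adj B Bs G e m)) = 0"
    have "(\<Sum>e\<in>I. c e *\<^sub>R graph_vec B Bs G e (rot90 *v graph_adj B Bs G e n))
        = M (\<Sum>e\<in>I. c e *\<^sub>R graph_vec B Bs G e (rot90 *v graph_adj B Bs G e m))"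
      by (simp add: linear_sum[OF M(1)] linear_cmul[OF M(1)] v)
    then have "(\<Sum>e\<in>I. c e *\<^sub>R graph_vec B Bs G e (rot90 *v graph_adj B Bs G e n)) = 0"
      by (simp add: c linear_0[OF M(1)])
    then show "\<forall>e\<in>I. c e = 0" using lin_indep_familyD[OF ind] by blast
  qed
  then show thesis using that by (simp add: m_def)
qed

end

section \<open>Contraction\<close>

lemma dim_image_kernel:
  fixes f :: "'a::euclidean_space \<Rightarrow> 'b::euclidean_space"
  assumes f: "linear f" and S: "subspace S"
  shows "dim S = dim (f ` S) + dim {x \<in> S. f x = 0}"
proof -
  define K where "K = {x \<in> S. f x = 0}"
  define T where "T = {y \<in> S. \<forall>x\<in>K. orthogonal x y}"
  have K: "subspace K" using S unfolding K_def subspace_def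
    by (auto simp: linear_0[OF f] linear_add[OF f] linear_cmul[OF f])
  have T: "subspace T" using S unfolding T_def subspace_def
    by (auto simp: orthogonal_def inner_add_right)
  have "K \<subseteq> S" by (auto simp: K_def)
  then have "dim T + dim K = dim S"
    unfolding T_def by (rule dim_subspace_orthogonal_to_vectors[OF K S])
  moreover have "inj_on f (span T)"
  proof (rule inj_onI)
    fix x y assume xy: "x \<in> span T" "y \<in> span T" "f x = f y"
    then have "x - y \<in> T" using T subspace_diff unfolding span_eq_iff[THEN iffD2, OF T] by blast
    moreover from this have "x - y \<in> K"
      using xy(3) by (simp add: K_def T_def linear_diff[OF f])
    ultimately have "orthogonal (x - y) (x - y)" unfolding T_def by blast
    then show "x = y" by (simp add: orthogonal_self)
  qed
  then have "dim (f ` T) = dim T" by (rule dim_image_eq[OF f])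
  moreover have "f ` T = f ` S"
  proof (intro equalityI subsetI)
    fix z assume "z \<in> f ` S"
    then obtain s where s: "s \<in> S" "z = f s" by blast
    obtain k t where kt: "k \<in> span K" "\<And>w. w \<in> span K \<Longrightarrow> orthogonal t w" "s = k + t"
    proof (rule orthogonal_subspace_decomp_exists[of K s])
      fix y z assume "y \<in> span K" "\<And>w. w \<in> span K \<Longrightarrow> orthogonal z w" "s = y + z"
      then show thesis by (rule that)
    qed
    have k: "k \<in> S" "f k = 0" using kt(1)
        unfolding span_eq_iff[THEN iffD2, OF K] by (auto simp: K_def)
    have "t = s - k" using kt(3) by simp
    then have "t \<in> S" "f t = z" using s k S by (simp_all add: subspace_diff linear_diff[OF f])
    moreover have "orthogonal x t" if "x \<in> K" for x
      using kt(2)[OF span_base[OF that]] by (rule orthogonal_commute[THEN iffD1])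
    ultimately have "t \<in> T" "z = f t" by (auto simp: T_def)
    then show "z \<in> f ` T" by blast
  qed (auto simp: T_def)
  ultimately show ?thesis by (simp add: K_def)
qed

definition vertex_space :: "'w::finite set \<Rightarrow> (((real^2)^'w) \<times> (real^'k::finite)) set" where
  "vertex_space V = {(x, y). y = 0 \<and> (\<forall>w. w \<notin> V \<longrightarrow> x $ w = 0)}"

lemma subspace_vertex_space: "subspace (vertex_space V)"
  by (auto simp: vertex_space_def subspace_def zero_prod_def)

lemma dim_vertex_space:
  "dim (vertex_space V :: (((real^2)^'w::finite) \<times> (real^'k::finite)) set) = 2 * card V"
proof -
  let ?d = "(\<lambda>(w, b). axis w b :: (real^2)^'w) ` (V \<times> Basis)"
  let ?S = "{x :: (real^2)^'w. \<forall>w. w \<notin> V \<longrightarrow> x $ w = 0}"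
  have inj: "inj_on (\<lambda>(w, b). axis w b :: (real^2)^'w) (V \<times> Basis)"
    by (auto simp: inj_on_def axis_eq_axis)
  have d: "?d \<subseteq> Basis" by auto
  have "?S = {x. \<forall>i\<in>Basis. i \<notin> ?d \<longrightarrow> x \<bullet> i = 0}"
  proof (intro equalityI subsetI CollectI ballI impI allI)
    fix x i assume x: "x \<in> ?S" and i: "(i :: (real^2)^'w) \<in> Basis" "i \<notin> ?d"
    then obtain w b where "i = axis w b" "b \<in> Basis" by (auto simp: Basis_vec_def)
    with i have "w \<notin> V" by auto
    then show "x \<bullet> i = 0" using x \<open>i = axis w b\<close> by (simp add: inner_axis)
  next
    fix x :: "(real^2)^'w" and w assume x: "x \<in> {x. \<forall>i\<in>Basis. i \<notin> ?d \<longrightarrow> x \<bullet> i = 0}" and w: "w \<notin> V"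
    show "x $ w = 0"
    proof (rule euclidean_eqI)
      fix b :: "real^2" assume b: "b \<in> Basis"
      have "axis w b \<notin> ?d"
        using w b by (auto simp: axis_eq_axis)
      then have "x \<bullet> axis w b = 0" using x b by simp
      then show "x $ w \<bullet> b = 0 \<bullet> b" by (simp add: inner_axis)
    qed
  qed
  then have "dim ?S = card ?d" using dim_substandard[OF d] by simp
  also have "\<dots> = 2 * card V" by (simp add: card_image[OF inj] card_cartesian_product)
  finally have dS: "dim ?S = 2 * card V" .
  let ?f = "\<lambda>x. (x, 0) :: ((real^2)^'w) \<times> (real^'k)"
  have "linear ?f" by (rule linearI) simp_all
  moreover have "inj_on ?f (span ?S)" by (simp add: inj_on_def)
  ultimately have "dim (?f ` ?S) = dim ?S" by (rule dim_image_eq)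
  moreover have "?f ` ?S = vertex_space V" by (auto simp: vertex_space_def)
  ultimately show ?thesis using dS by simp
qed

section \<open>Components and the contraction map\<close>

definition adjacency :: "('v, 'e) gain_graph \<Rightarrow> 'e set \<Rightarrow> ('v \<times> 'v) set" where
  "adjacency G F = {(src G e, tgt G e) | e. e \<in> F} \<union> {(tgt G e, src G e) | e. e \<in> F}"

lemma component_eq: "component G F v = (adjacency G F)\<^sup>* `` {v}"
  by (auto simp: component_def adjacency_def)

lemma sym_adjacency: "sym (adjacency G F)"
  by (auto simp: adjacency_def sym_def)

lemma sym_rtrancl_adjacency: "(v, w) \<in> (adjacency G F)\<^sup>* \<Longrightarrow> (w, v) \<in> (adjacency G F)\<^sup>*"
  using sym_rtrancl[OF sym_adjacency] by (rule symD)

lemma component_self: "v \<in> component G F v"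
  by (simp add: component_eq)

lemma component_cong: "w \<in> component G F v \<Longrightarrow> component G F w = component G F v"
  unfolding component_eq by (auto dest: sym_rtrancl_adjacency intro: rtrancl_trans)

lemma components_eqD: "S \<in> components G F \<Longrightarrow> v \<in> S \<Longrightarrow> S = component G F v"
  unfolding components_def using component_cong by fastforce

lemma component_subset_edge_verts:
  assumes "v \<in> edge_verts G F"
  shows "component G F v \<subseteq> edge_verts G F"
proof
  fix w assume "w \<in> component G F v"
  then have "(v, w) \<in> (adjacency G F)\<^sup>*" by (simp add: component_eq)
  then show "w \<in> edge_verts G F"
    using assms by induction (auto simp: adjacency_def edge_verts_def)
qed

text \<open>The index type consists of all vertex sets; those that are not components get the
  coordinate 0.\<close>

definition contract :: "('v::finite, 'e) gain_graph \<Rightarrow> 'e set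
    \<Rightarrow> ((real^2)^'v) \<times> (real^'k::finite) \<Rightarrow> ((real^2)^('v set)) \<times> (real^'k)" where
  "contract G F n = (\<chi> S. if S \<in> components G F then \<Sum>v\<in>S. fst n $ v else 0, snd n)"

lemma linear_contract: "linear (contract G F)"
  by (rule linearI) (simp_all add: contract_def vec_eq_iff sum.distrib sum_distrib_left)

lemma contract_axis:
  assumes "v \<in> edge_verts G F"
  shows "(\<chi> S. if S \<in> components G F then \<Sum>w\<in>S. axis v a $ w else 0)
      = axis (component G F v) (a :: real^2)"
proof -
  have "(if S \<in> components G F then \<Sum>w\<in>S. axis v a $ w else 0) = axis (component G F v) a $ S" for S
  proof (cases "S = component G F v")
    case True
    then have "S \<in> components G F" "v \<in> S" using assms component_self by (auto simp: components_def)
    then have "(\<Sum>w\<in>S. axis v a $ w) = (\<Sum>w\<in>{v}. axis v a $ w)"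
      by (intro sum.mono_neutral_right) (auto simp: axis_def)
    then show ?thesis using True \<open>S \<in> components G F\<close> by simp
  next
    case False
    have "(\<Sum>w\<in>S. axis v a $ w) = 0" if "S \<in> components G F"
    proof (rule sum.neutral, rule ballI)
      fix w assume "w \<in> S"
      then have "w \<noteq> v" using False components_eqD[OF that, of v] by blast
      then show "axis v a $ w = 0" by (simp add: axis_def)
    qed
    then show ?thesis using False by (simp add: axis_def)
  qed
  then show ?thesis by (simp add: vec_eq_iff)
qed

text \<open>Contraction adds the coordinates at the two ends. If they lie in one component, the sum
  is the coordinate of the loop, so no separate case arises.\<close>

lemma contract_edge_vec:
  assumes "i \<in> edge_verts G F" "j \<in> edge_verts G F"
  shows "contract G F (edge_vec B Bs i j \<phi> a)
      = edge_vec B Bs (component G F i) (component G F j) \<phi> a"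
proof -
  have "(\<chi> S. if S \<in> components G F then \<Sum>v\<in>S. (axis i a - axis j (transpose (fst \<phi>) *v a)) $ v
      else 0)
    = (\<chi> S. if S \<in> components G F then \<Sum>v\<in>S. axis i a $ v else 0)
      - (\<chi> S. if S \<in> components G F then \<Sum>v\<in>S. axis j (transpose (fst \<phi>) *v a) $ v else 0)"
    by (simp add: vec_eq_iff sum_subtractf)
  then show ?thesis
    unfolding contract_def edge_vec_def fst_conv snd_conv contract_axis[OF assms(1)]
        contract_axis[OF assms(2)]
    by simp
qed

lemma vertex_space_eq_sum:
  assumes "n \<in> (vertex_space V :: (((real^2)^'w::finite) \<times> (real^'k::finite)) set)"
  shows "n = (\<Sum>v\<in>V. (axis v (fst n $ v), 0))"
proof -
  have "fst n $ w = (\<Sum>v\<in>V. axis v (fst n $ v) $ w)" for w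
  proof (cases "w \<in> V")
    case True
    have "(\<Sum>v\<in>V. axis v (fst n $ v) $ w) = (\<Sum>v\<in>{w}. axis v (fst n $ v) $ w)"
      using True by (intro sum.mono_neutral_right) (auto simp: axis_def)
    then show ?thesis by simp
  next
    case False
    then have "(\<Sum>v\<in>V. axis v (fst n $ v) $ w) = 0"
      by (intro sum.neutral) (auto simp: axis_def)
    then show ?thesis using assms False by (auto simp: vertex_space_def)
  qed
  then have f: "fst n = (\<Sum>v\<in>V. axis v (fst n $ v))" by (simp add: vec_eq_iff)
  have "snd n = 0" using assms by (auto simp: vertex_space_def)
  then show ?thesis
    by (intro prod_eqI) (simp_all only: fst_sum snd_sum fst_conv snd_conv f[symmetric]
        sum.neutral_const)
qed

lemma axis_in_vertex_space: "v \<in> V \<Longrightarrow> (axis v a, 0) \<in> vertex_space V"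
  by (auto simp: vertex_space_def axis_def)

lemma contract_axis_pair:
  assumes "v \<in> edge_verts G F"
  shows "contract G F (axis v a, 0) = (axis (component G F v) a, 0)"
  unfolding contract_def fst_conv snd_conv contract_axis[OF assms] ..

text \<open>Surjectivity fixes the kernel dimension on the vertex space as
  \<open>2 |V| - 2 c\<close>.\<close>

lemma contract_vertex_space:
  "contract G F ` (vertex_space (edge_verts G F) :: (((real^2)^'v::finite) \<times> (real^'k::finite)) set)
    = vertex_space (components G F)"
proof (intro equalityI subsetI)
  fix z :: "((real^2)^('v set)) \<times> (real^'k)"
  assume "z \<in> contract G F ` vertex_space (edge_verts G F)"
  then show "z \<in> vertex_space (components G F)" by (auto simp: vertex_space_def contract_def)
next
  fix z :: "((real^2)^('v set)) \<times> (real^'k)"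
  assume z: "z \<in> vertex_space (components G F)"
  let ?S = "contract G F ` (vertex_space (edge_verts G F) :: (((real^2)^'v) \<times> (real^'k)) set)"
  have S: "subspace ?S"
    by (rule linear_subspace_image[OF linear_contract subspace_vertex_space])
  have ax: "(axis c (fst z $ c), 0) \<in> ?S" if "c \<in> components G F" for c
  proof -
    obtain v where v: "v \<in> edge_verts G F" "c = component G F v"
      using \<open>c \<in> components G F\<close> by (auto simp: components_def)
    have "(axis c (fst z $ c), 0) = contract G F (axis v (fst z $ c), 0)"
      unfolding contract_axis_pair[OF v(1)] v(2) ..
    then show ?thesis using axis_in_vertex_space[OF v(1)] by blast
  qed
  have "(\<Sum>c\<in>components G F. (axis c (fst z $ c), 0)) \<in> ?S"
    by (rule subspace_sum[OF S ax])
  then show "z \<in> ?S" using vertex_space_eq_sum[OF z] by simp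
qed

lemma fibre_component:
  assumes "S \<in> components G F"
  shows "{v \<in> edge_verts G F. component G F v = S} = S"
proof -
  obtain v where "v \<in> edge_verts G F" "S = component G F v"
      using assms by (auto simp: components_def)
  then have sub: "S \<subseteq> edge_verts G F" using component_subset_edge_verts by simp
  show ?thesis
  proof (intro equalityI subsetI)
    fix v assume "v \<in> S"
    then show "v \<in> {v \<in> edge_verts G F. component G F v = S}"
      using sub components_eqD[OF assms, of v] by auto
  next
    fix v assume "v \<in> {v \<in> edge_verts G F. component G F v = S}"
    then show "v \<in> S" using component_self[of v G F] by simp
  qed
qed

text \<open>Every coordinate of \<open>n\<close> is moved to a representative of its component by a
  difference vector in \<open>X\<close>. The moved copies (the terms \<open>?z v\<close>) add up to
  zero, because the coordinates of \<open>n\<close> sum to zero over each component.\<close>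

lemma contract_kernel_subset:
  fixes G :: "('v::finite, 'e) gain_graph" and X :: "(((real^2)^'v) \<times> (real^'k::finite)) set"
  assumes X: "subspace X"
    and diff: "\<And>v w a. v \<in> edge_verts G F \<Longrightarrow> w \<in> component G F v \<Longrightarrow> (axis v a - axis w a, 0) \<in> X"
    and n: "n \<in> vertex_space (edge_verts G F)" "contract G F n = 0"
  shows "n \<in> X"
proof -
  let ?V = "edge_verts G F" and ?comp = "component G F"
  define r where "r S = (SOME v. v \<in> S)" for S :: "'v set"
  have r: "r (?comp v) \<in> ?comp v" for v
    unfolding r_def by (rule someI[of _ v]) (rule component_self)
  let ?z = "\<lambda>v. (axis (r (?comp v)) (fst n $ v), 0) :: ((real^2)^'v) \<times> (real^'k)"
  have sums: "(\<Sum>v\<in>S. fst n $ v) = 0" if "S \<in> components G F" for S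
  proof -
    have "fst (contract G F n) $ S = (\<Sum>v\<in>S. fst n $ v)" using that by (simp add: contract_def)
    then show ?thesis by (simp add: n(2))
  qed
  have "(\<Sum>v\<in>?V. ?z v) = (\<Sum>S\<in>components G F. \<Sum>v\<in>{v \<in> ?V. ?comp v = S}. ?z v)"
    by (rule sum.group[symmetric]) (auto simp: components_def)
  also have "\<dots> = 0"
  proof (rule sum.neutral, rule ballI)
    fix S assume S: "S \<in> components G F"
    have "(\<Sum>v\<in>{v \<in> ?V. ?comp v = S}. ?z v)
        = (\<Sum>v\<in>{v \<in> ?V. ?comp v = S}. (axis (r S) (fst n $ v), 0))"
      by (rule sum.cong) auto
    also have "\<dots> = (\<Sum>v\<in>S. (axis (r S) (fst n $ v), 0))" by (simp only: fibre_component[OF S])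
    also have "\<dots> = (axis (r S) (\<Sum>v\<in>S. fst n $ v), 0)"
    proof -
      have lin: "linear (\<lambda>a. (axis (r S) a, 0) :: ((real^2)^'v) \<times> (real^'k))"
        by (rule linearI) (simp_all add: vec_eq_iff axis_def)
      show ?thesis by (rule linear_sum[OF lin, symmetric])
    qed
    also have "\<dots> = 0" by (simp add: sums[OF S] zero_prod_def)
    finally show "(\<Sum>v\<in>{v \<in> ?V. ?comp v = S}. ?z v) = 0" .
  qed
  finally have z0: "(\<Sum>v\<in>?V. ?z v) = 0" .
  have "n = (\<Sum>v\<in>?V. (axis v (fst n $ v), 0)) - (\<Sum>v\<in>?V. ?z v)"
    unfolding z0 using vertex_space_eq_sum[OF n(1)] by simp
  also have "\<dots> = (\<Sum>v\<in>?V. (axis v (fst n $ v) - axis (r (?comp v)) (fst n $ v), 0))"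
    unfolding sum_subtractf[symmetric] by simp
  also have "\<dots> \<in> X"
    by (rule subspace_sum[OF X]) (rule diff[OF _ r])
  finally show ?thesis .
qed

text \<open>Rank-nullity is applied to \<open>contract\<close> twice, on the span \<open>X\<close>
  of the edge vectors and on the vertex space. The two kernels coincide, so the second computation
  supplies the nullity needed in the first.\<close>

lemma dim_contract:
  fixes G :: "('v::finite, 'e) gain_graph" and Bs :: "'k::finite \<Rightarrow> real^2^2"
  assumes T: "T \<subseteq> F" "\<And>e. e \<in> T \<Longrightarrow> gain G e = (mat 1, 0)"
    and conn: "\<And>v. v \<in> edge_verts G F \<Longrightarrow> component G F v \<subseteq> component G T v"
  shows "int (dim (span (\<Union>e\<in>F. range (graph_vec B Bs G e))))
    = 2 * int (card (edge_verts G F)) - 2 * int (card (components G F))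
      + int (dim (span (\<Union>e\<in>F. range (graph_vec B Bs (compressed_graph G F (gain G)) e))))"
proof -
  let ?V = "edge_verts G F" and ?C = "contract G F :: ((real^2)^'v) \<times> (real^'k) \<Rightarrow> _"
  let ?Y = "vertex_space ?V :: (((real^2)^'v) \<times> (real^'k)) set"
  define E where "E = (\<Union>e\<in>F. range (graph_vec B Bs G e))"
  define X where "X = span E"
  have X: "subspace X" by (simp add: X_def)
  have src_tgt: "src G e \<in> ?V" "tgt G e \<in> ?V" if "e \<in> F" for e
    using that by (auto simp: edge_verts_def)
  have img: "?C ` X = span (\<Union>e\<in>F. range (graph_vec B Bs (compressed_graph G F (gain G)) e))"
  proof -
    have "?C (graph_vec B Bs G e a) = graph_vec B Bs (compressed_graph G F (gain G)) e a"
      if "e \<in> F" for e a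
      using contract_edge_vec[OF src_tgt[OF that], of B Bs "gain G e" a]
      by (simp add: compressed_graph_def)
    then have "?C ` range (graph_vec B Bs G e)
        = range (graph_vec B Bs (compressed_graph G F (gain G)) e)"
      if "e \<in> F" for e
      unfolding image_image using that by (intro image_cong refl) blast
    then have "?C ` E = (\<Union>e\<in>F. range (graph_vec B Bs (compressed_graph G F (gain G)) e))"
      unfolding E_def image_UN by (intro SUP_cong refl)
    then show ?thesis unfolding X_def using linear_span_image[OF linear_contract, of G F E] by simp
  qed
  have edge: "(axis v a - axis w a, 0) \<in> X" if vw: "(v, w) \<in> adjacency G T" for v w a
  proof -
    obtain e where e: "e \<in> T" "(v, w) = (src G e, tgt G e) \<or> (v, w) = (tgt G e, src G e)"
      using vw unfolding adjacency_def by blast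
    have "graph_vec B Bs G e b \<in> X" for b
      unfolding X_def E_def using e(1) T(1) by (intro span_base) blast
    moreover have "graph_vec B Bs G e b = (axis (src G e) b - axis (tgt G e) b, 0)" for b
      using T(2)[OF e(1)] by (simp add: edge_vec_def bvec_def vec_eq_iff del:
          transpose_matrix_vector)
    ultimately have m: "(axis (src G e) b - axis (tgt G e) b, 0) \<in> X" for b by metis
    \<comment> \<open>An edge traversed backwards contributes the same difference with the parameter
      \<open>- a\<close>.\<close>
    have "axis w (- a) = - (axis w a :: (real^2)^'v)" "axis v (- a) = - (axis v a :: (real^2)^'v)"
      by (simp_all add: vec_eq_iff axis_def)
    then show ?thesis using e(2) m[of a] m[of "- a"] by auto
  qed
  have path: "(axis v a - axis w a, 0) \<in> X" if "(v, w) \<in> (adjacency G T)\<^sup>*" for v w a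
    using that
  proof induction
    case base
    then show ?case using subspace_0[OF X] by (simp add: zero_prod_def)
  next
    case (step w z)
    from subspace_add[OF X step.IH edge[OF step.hyps(2), of a]]
    show ?case by simp
  qed
  \<comment> \<open>Vectors of \<open>X\<close> live on the vertices of \<open>F\<close>, and
    \<open>contract\<close> keeps the lattice part, so a kernel vector has lattice part 0.
    Conversely, paths in \<open>T\<close> with trivial gains put all differences within a component
    into \<open>X\<close>.\<close>
  have "{x \<in> X. ?C x = 0} = {x \<in> ?Y. ?C x = 0}"
  proof (intro equalityI subsetI)
    fix x assume x: "x \<in> {x \<in> X. ?C x = 0}"
    let ?Z = "{n :: ((real^2)^'v) \<times> (real^'k). \<forall>w. w \<notin> ?V \<longrightarrow> fst n $ w = 0}"
    have "X \<subseteq> ?Z" unfolding X_def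
    proof (rule span_minimal)
      show "subspace ?Z" by (auto simp: subspace_def)
      show "E \<subseteq> ?Z" unfolding E_def using src_tgt by (fastforce simp: edge_vec_def axis_def)
    qed
    moreover have "snd x = 0" using x by (simp add: contract_def prod_eq_iff)
    ultimately show "x \<in> {x \<in> ?Y. ?C x = 0}" using x by (auto simp: vertex_space_def)
  next
    fix x assume x: "x \<in> {x \<in> ?Y. ?C x = 0}"
    have "x \<in> X"
    proof (rule contract_kernel_subset[OF X])
      show "(axis v a - axis w a, 0) \<in> X" if "v \<in> ?V" "w \<in> component G F v" for v w a
        using conn[OF that(1)] that(2) by (intro path) (auto simp: component_eq)
    qed (use x in auto)
    then show "x \<in> {x \<in> X. ?C x = 0}" using x by simp
  qed
  moreover have "dim X = dim (?C ` X) + dim {x \<in> X. ?C x = 0}"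
    by (rule dim_image_kernel[OF linear_contract X])
  moreover have "dim ?Y = dim (?C ` ?Y) + dim {x \<in> ?Y. ?C x = 0}"
    by (rule dim_image_kernel[OF linear_contract subspace_vertex_space])
  ultimately have "int (dim X)
      = 2 * int (card ?V) - 2 * int (card (components G F)) + int (dim (?C ` X))"
    by (simp add: contract_vertex_space dim_vertex_space)
  then show ?thesis unfolding img unfolding X_def E_def .
qed

section \<open>Forests and switching\<close>

text \<open>Walk round the cycle the other way, starting behind the edge \<open>m\<close>. After
  \<open>length es - 1\<close> steps the walk is at the first end of that edge and has avoided it; a
  loop needs no step.\<close>

lemma cycle_edge_connected:
  assumes cyc: "is_cycle G vs es" and m: "m < length es"
    and others: "\<And>i. i < length es \<Longrightarrow> i \<noteq> m \<Longrightarrow> es ! i \<in> T"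
  shows "(src G (es ! m), tgt G (es ! m)) \<in> (adjacency G T)\<^sup>*"
proof -
  let ?n = "length es"
  have n: "?n > 0" using m by linarith
  have ends: "{src G (es ! i), tgt G (es ! i)} = {vs ! i, vs ! (Suc i mod ?n)}" if "i < ?n" for i
    using cyc that by (simp add: is_cycle_def)
  have adj: "(vs ! i, vs ! (Suc i mod ?n)) \<in> adjacency G T" if "i < ?n" "i \<noteq> m" for i
    using ends[OF that(1)] others[OF that] unfolding adjacency_def doubleton_eq_iff by force
  have "(vs ! (Suc m mod ?n), vs ! ((Suc m + k) mod ?n)) \<in> (adjacency G T)\<^sup>*" if "k < ?n" for k
    using that
  proof (induction k)
    case (Suc k)
    let ?i = "(Suc m + k) mod ?n"
    have "?i < ?n" using n by simp
    moreover have "?i \<noteq> m"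
    proof (cases "Suc m + k < ?n")
      case False
      then have "?i = Suc m + k - ?n" using m Suc.prems by (simp add: mod_if)
      then show ?thesis using m Suc.prems False by linarith
    qed simp
    ultimately have "(vs ! ?i, vs ! (Suc ?i mod ?n)) \<in> adjacency G T" by (rule adj)
    moreover have "Suc ?i mod ?n = (Suc m + Suc k) mod ?n" by (simp add: mod_Suc_eq)
    ultimately show ?case using Suc by (auto intro: rtrancl_into_rtrancl)
  qed simp
  from this[of "?n - 1"] have "(vs ! (Suc m mod ?n), vs ! m) \<in> (adjacency G T)\<^sup>*"
    using m n by simp
  then have c: "(vs ! (Suc m mod ?n), vs ! m) \<in> (adjacency G T)\<^sup>*"
    "(vs ! m, vs ! (Suc m mod ?n)) \<in> (adjacency G T)\<^sup>*"
    by (simp_all add: sym_rtrancl_adjacency)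
  show ?thesis using ends[OF m] c unfolding doubleton_eq_iff by auto
qed

text \<open>An edge of \<open>F\<close> outside \<open>T\<close> closes a cycle whose other edges
  lie in \<open>T\<close>, so its ends are already joined in \<open>T\<close>.\<close>

lemma component_maximal_forest:
  assumes "maximal_forest G F T"
  shows "component G F v \<subseteq> component G T v"
proof -
  have TF: "T \<subseteq> F" and forest: "forest G T"
    and max: "\<And>T'. T \<subseteq> T' \<Longrightarrow> T' \<subseteq> F \<Longrightarrow> forest G T' \<Longrightarrow> T' = T"
    using assms by (auto simp: maximal_forest_def)
  have edge: "(src G e, tgt G e) \<in> (adjacency G T)\<^sup>*" if e: "e \<in> F" for e
  proof (cases "e \<in> T")
    case True
    then show ?thesis by (auto simp: adjacency_def)
  next
    case False
    then have "\<not> forest G (insert e T)" using max[of "insert e T"] e TF by blast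
    then obtain vs es where cyc: "set es \<subseteq> insert e T" "is_cycle G vs es"
      unfolding forest_def by blast
    have "e \<in> set es" using cyc forest unfolding forest_def by blast
    then obtain m where m: "m < length es" "es ! m = e" by (auto simp: in_set_conv_nth)
    have "es ! i \<in> T" if "i < length es" "i \<noteq> m" for i
    proof -
      have "distinct es" using cyc(2) by (simp add: is_cycle_def)
      then have "es ! i \<noteq> e" using that m nth_eq_iff_index_eq by metis
      moreover have "es ! i \<in> insert e T" using cyc(1) nth_mem[OF that(1)] by blast
      ultimately show ?thesis by simp
    qed
    then show ?thesis using cycle_edge_connected[OF cyc(2) m(1)] m(2) by blast
  qed
  have "adjacency G F \<subseteq> (adjacency G T)\<^sup>*"
  proof
    fix x assume "x \<in> adjacency G F"
    then obtain e where e: "e \<in> F" "x = (src G e, tgt G e) \<or> x = (tgt G e, src G e)"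
      by (auto simp: adjacency_def)
    then show "x \<in> (adjacency G T)\<^sup>*"
      using edge[OF e(1)] sym_rtrancl_adjacency[OF edge[OF e(1)]] by auto
  qed
  then have "(adjacency G F)\<^sup>* \<subseteq> (adjacency G T)\<^sup>*" by (rule rtrancl_subset_rtrancl)
  then show ?thesis unfolding component_eq by blast
qed

section \<open>Invariance under switching\<close>

lemma euclid_mult: "x \<otimes>\<^bsub>euclid\<^esub> y = (fst x ** fst y, fst x *v snd y + snd x)"
  by (simp add: euclid_def case_prod_beta)

lemma euclid_one: "\<one>\<^bsub>euclid\<^esub> = (mat 1, 0)"
  by (simp add: euclid_def)

lemma euclid_inv:
  assumes "x \<in> carrier euclid"
  shows "inv\<^bsub>euclid\<^esub> x = (transpose (fst x), - (transpose (fst x) *v snd x))"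
proof (rule group.inv_equality[OF group_euclid])
  have A: "transpose (fst x) ** fst x = mat 1"
      using assms by (auto simp: euclid_def orthogonal_matrix)
  show "(transpose (fst x), - (transpose (fst x) *v snd x)) \<otimes>\<^bsub>euclid\<^esub> x = \<one>\<^bsub>euclid\<^esub>"
    by (simp add: euclid_mult euclid_one A)
  show "(transpose (fst x), - (transpose (fst x) *v snd x)) \<in> carrier euclid"
    using assms by (auto simp: euclid_def)
qed (use assms in simp)

context rotation_lattice
begin

lemma in_carrier: "\<gamma> \<in> \<Gamma> \<Longrightarrow> \<gamma> \<in> carrier euclid"
  using subgroup.mem_carrier[OF subgroup] .

text \<open>The coordinate change of the ambient space induced by switching every vertex
  \<open>w\<close> with \<open>f w\<close> at once: linear parts act on the vertex coordinates, and
  the translations are absorbed by the lattice part.\<close>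

definition switch_map :: "('w::finite \<Rightarrow> isom) \<Rightarrow> ((real^2)^'w) \<times> (real^'k) \<Rightarrow> ((real^2)^'w) \<times>
    (real^'k)" where
  "switch_map f n = (\<chi> w. fst (f w) *v (fst n $ w),
     snd n - (\<Sum>w\<in>UNIV. bvec B Bs (fst (f w) *v (fst n $ w)) (snd (f w))))"

lemma bvec_linear:
  "bvec B Bs (a + b) t = bvec B Bs a t + bvec B Bs b t"
  "bvec B Bs (a - b) t = bvec B Bs a t - bvec B Bs b t"
  "bvec B Bs (c *\<^sub>R a) t = c *\<^sub>R bvec B Bs a t"
  "bvec B Bs a (s + t) = bvec B Bs a s + bvec B Bs a t"
  "bvec B Bs a (- t) = - bvec B Bs a t"
  "bvec B Bs 0 t = 0"
  by (simp_all add: bvec_def vec_eq_iff inner_add_left inner_diff_left inner_add_right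
      matrix_vector_right_distrib linear_neg[OF matrix_vector_mul_linear])

lemma linear_switch_map: "linear (switch_map f)"
  by (rule linearI)
    (simp_all add: switch_map_def vec_eq_iff matrix_vector_right_distrib bvec_linear
      matrix_vector_mult_scaleR sum.distrib scaleR_sum_right scaleR_diff_right)

lemma inj_switch_map:
  assumes f: "\<And>w. f w \<in> \<Gamma>"
  shows "inj (switch_map f)"
proof (rule linear_injective_0[OF linear_switch_map, THEN iffD2], intro allI impI)
  fix n assume z: "switch_map f n = 0"
  have "fst n $ w = 0" for w
  proof -
    have "fst (f w) *v (fst n $ w) = fst (switch_map f n) $ w" by (simp add: switch_map_def)
    then have "fst (f w) *v (fst n $ w) = 0" by (simp add: z)
    then have "transpose (fst (f w)) *v (fst (f w) *v (fst n $ w)) = 0"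
        by (simp only: matrix_vector_mult_0_right)
    then show ?thesis by (simp only: orthogonal_matrix_vector_cancel[OF orthogonal[OF f]])
  qed
  then have "fst n = 0" by (simp add: vec_eq_iff)
  moreover from this have "snd n = snd (switch_map f n)" by (simp add: switch_map_def bvec_linear)
  ultimately show "n = 0" by (simp add: z prod_eq_iff)
qed

text \<open>Orthogonal changes cancel inside \<open>bvec\<close>, so the new translation contributes
  the old term plus one term for each end. These two are the correction made by
  \<open>switch_map\<close>, whose vertex coordinates are nonzero only at the ends; treating all
  vertices by one sum covers loops too.\<close>

lemma switch_map_edge_vec:
  assumes f: "\<And>w. f w \<in> \<Gamma>" and \<phi>: "\<phi> \<in> \<Gamma>"
  shows "edge_vec B Bs i j (f i \<otimes>\<^bsub>euclid\<^esub> \<phi> \<otimes>\<^bsub>euclid\<^esub> inv\<^bsub>euclid\<^esub> (f j)) (fst (f i) *v a)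
    = switch_map f (edge_vec B Bs i j \<phi> a :: ((real^2)^'w::finite) \<times> (real^'k))"
proof -
  let ?Ai = "fst (f i)" and ?Aj = "fst (f j)" and ?A = "fst \<phi>"
  let ?b = "bvec B Bs"
  note cancel_i = orthogonal_matrix_vector_cancel[OF orthogonal[OF f[of i]]]
  note cancel_j = orthogonal_matrix_vector_cancel[OF orthogonal[OF f[of j]]]
  have b: "?b (fst \<gamma> *v u) (fst \<gamma> *v s) = ?b u s" if "\<gamma> \<in> \<Gamma>" for \<gamma> u s
    using bvec_transpose[OF that, of "fst \<gamma> *v u" s]
    by (simp only: orthogonal_matrix_vector_cancel[OF orthogonal[OF that]])
  let ?u = "transpose ?A *v a"
  have gain: "f i \<otimes>\<^bsub>euclid\<^esub> \<phi> \<otimes>\<^bsub>euclid\<^esub> inv\<^bsub>euclid\<^esub> (f j)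
      = (?Ai ** ?A ** transpose ?Aj,
         - (?Ai *v (?A *v (transpose ?Aj *v snd (f j)))) + (?Ai *v snd \<phi> + snd (f i)))"
    unfolding euclid_mult euclid_inv[OF in_carrier[OF f]] fst_conv snd_conv
    by (simp add: linear_neg[OF matrix_vector_mul_linear] matrix_vector_mul_assoc matrix_mul_assoc
        del: transpose_matrix_vector)
  have tr: "transpose (?Ai ** ?A ** transpose ?Aj) *v (?Ai *v a) = ?Aj *v ?u"
  proof -
    have "transpose (?Ai ** ?A ** transpose ?Aj) *v (?Ai *v a)
        = ?Aj *v (transpose ?A *v (transpose ?Ai *v (?Ai *v a)))"
      by (simp only: matrix_transpose_mul transpose_transpose matrix_vector_mul_assoc
          matrix_mul_assoc)
    then show ?thesis by (simp only: cancel_i)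
  qed
  have "?b (?Aj *v ?u) (snd (f j)) = ?b ?u (transpose ?Aj *v snd (f j))"
    using b[OF f[of j], of ?u "transpose ?Aj *v snd (f j)"] by (simp only: cancel_j)
  also have "\<dots> = ?b a (?A *v (transpose ?Aj *v snd (f j)))" by (rule bvec_transpose[OF \<phi>])
  finally have bj: "?b a (?A *v (transpose ?Aj *v snd (f j))) = ?b (?Aj *v ?u) (snd (f j))" ..
  have snd_eq: "?b (?Ai *v a)
      (- (?Ai *v (?A *v (transpose ?Aj *v snd (f j)))) + (?Ai *v snd \<phi> + snd (f i)))
      = - ?b (?Aj *v ?u) (snd (f j)) + (?b a (snd \<phi>) + ?b (?Ai *v a) (snd (f i)))"
    by (simp only: bvec_linear b[OF f] bj)
  have ax: "fst (f w) *v (axis v c $ w) = axis v (fst (f v) *v c) $ w" for v w and c :: "real^2"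
    by (simp add: axis_def)
  have "(\<Sum>w\<in>UNIV. ?b (axis v c $ w) (snd (f w))) = ?b c (snd (f v))" for v :: 'w and c
  proof -
    have "(\<Sum>w\<in>UNIV. ?b (axis v c $ w) (snd (f w))) = (\<Sum>w\<in>{v}. ?b (axis v c $ w) (snd (f w)))"
      by (intro sum.mono_neutral_right) (auto simp: axis_def bvec_linear)
    then show ?thesis by simp
  qed
  then have sm: "(\<Sum>w\<in>UNIV. ?b (fst (f w) *v ((axis i a - axis j ?u) $ w)) (snd (f w)))
      = ?b (?Ai *v a) (snd (f i)) - ?b (?Aj *v ?u) (snd (f j))"
    by (simp add: matrix_vector_mult_diff_distrib ax bvec_linear sum_subtractf del:
        transpose_matrix_vector)
  have fs: "(\<chi> w. fst (f w) *v ((axis i a - axis j ?u) $ w))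
      = axis i (?Ai *v a) - axis j (?Aj *v ?u)"
    by (simp add: vec_eq_iff matrix_vector_mult_diff_distrib ax del: transpose_matrix_vector)
  show ?thesis
    unfolding switch_map_def gain edge_vec_def fst_conv snd_conv tr snd_eq fs sm by simp
qed

text \<open>One conjugation formula replaces the four cases of \<open>switch\<close>, since
  \<open>f\<close> is the identity away from \<open>v\<close>.\<close>

lemma switch_gain:
  assumes "gain H e \<in> \<Gamma>" "\<gamma> \<in> \<Gamma>" and f: "f = (\<lambda>w. if w = v then \<gamma> else \<one>\<^bsub>euclid\<^esub>)"
  shows "gain (switch v \<gamma> H) e
    = f (src H e) \<otimes>\<^bsub>euclid\<^esub> gain H e \<otimes>\<^bsub>euclid\<^esub> inv\<^bsub>euclid\<^esub> (f (tgt H e))"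
proof -
  interpret group euclid by (rule group_euclid)
  show ?thesis using in_carrier[OF assms(1)] in_carrier[OF assms(2)]
    by (auto simp: switch_def f)
qed

lemma dim_switch:
  fixes H :: "('w::finite, 'e) gain_graph"
  assumes \<gamma>: "\<gamma> \<in> \<Gamma>" and gains: "\<And>e. e \<in> F \<Longrightarrow> gain H e \<in> \<Gamma>"
  shows "dim (span (\<Union>e\<in>F. range (graph_vec B Bs (switch v \<gamma> H) e)))
    = dim (span (\<Union>e\<in>F. range (graph_vec B Bs H e)))"
proof -
  define f where "f = (\<lambda>w. if w = v then \<gamma> else \<one>\<^bsub>euclid\<^esub>)"
  have f: "f w \<in> \<Gamma>" for w using \<gamma> subgroup.one_closed[OF subgroup] by (simp add: f_def)
  have "range (graph_vec B Bs (switch v \<gamma> H) e) = switch_map f ` range (graph_vec B Bs H e)"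
    if e: "e \<in> F" for e
  proof -
    have ends: "src (switch v \<gamma> H) e = src H e" "tgt (switch v \<gamma> H) e = tgt H e"
      by (simp_all add: switch_def)
    have *: "graph_vec B Bs (switch v \<gamma> H) e (fst (f (src H e)) *v a)
        = switch_map f (graph_vec B Bs H e a)" for a
      unfolding ends switch_gain[OF gains[OF e] \<gamma> f_def]
      by (rule switch_map_edge_vec[OF f gains[OF e]])
    \<comment> \<open>The parameter is rotated along with the source; as this substitution is onto,
      it only reparametrises the flat.\<close>
    have "surj ((*v) (fst (f (src H e))))"
      by (rule surjI[of _ "(*v) (transpose (fst (f (src H e))))"])
        (rule orthogonal_matrix_vector_cancel[OF orthogonal[OF f]])
    then have "range (graph_vec B Bs (switch v \<gamma> H) e)
        = graph_vec B Bs (switch v \<gamma> H) e ` range ((*v) (fst (f (src H e))))" by (simp only:)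
    also have "\<dots> = switch_map f ` range (graph_vec B Bs H e)"
      unfolding image_image by (intro image_cong refl *)
    finally show ?thesis .
  qed
  then have "(\<Union>e\<in>F. range (graph_vec B Bs (switch v \<gamma> H) e))
      = switch_map f ` (\<Union>e\<in>F. range (graph_vec B Bs H e))"
    unfolding image_UN by (intro SUP_cong refl)
  then show ?thesis
    using dim_image_eq[OF linear_switch_map, of f "\<Union>e\<in>F. range (graph_vec B Bs H e)"]
      inj_on_subset[OF inj_switch_map[of f, OF f] subset_UNIV] by (simp add: dim_span)
qed

lemma switching_equiv_invariants:
  fixes G :: "('w::finite, 'e) gain_graph"
  assumes "switching_equiv \<Gamma> G H" "\<And>e. e \<in> F \<Longrightarrow> gain G e \<in> \<Gamma>"
  shows "src H = src G \<and> tgt H = tgt G \<and> (\<forall>e\<in>F. gain H e \<in> \<Gamma>) \<and>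
    dim (span (\<Union>e\<in>F. range (graph_vec B Bs H e))) = dim (span (\<Union>e\<in>F. range (graph_vec B Bs G e)))"
  using assms(1)
proof induction
  case switching_refl
  then show ?case using assms(2) by simp
next
  case (switching_step H v \<gamma>)
  interpret group euclid by (rule group_euclid)
  have "gain (switch v \<gamma> H) e \<in> \<Gamma>" if "e \<in> F" for e
  proof -
    have e: "gain H e \<in> \<Gamma>" using switching_step.IH that by blast
    show ?thesis unfolding switch_gain[OF e switching_step.hyps(3) refl]
      using e switching_step.hyps(3) subgroup
      by (intro subgroup.m_closed[OF subgroup] subgroup.m_inv_closed[OF subgroup])
        (simp_all add: subgroup.one_closed)
  qed
  moreover have "src (switch v \<gamma> H) = src H" "tgt (switch v \<gamma> H) = tgt H"
      by (simp_all add: switch_def)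
  ultimately show ?case using switching_step.IH dim_switch[OF switching_step.hyps(3), of F H v]
      by auto
qed

text \<open>Switching preserves the dimension and \<open>dim_contract\<close> accounts for the
  contraction. In particular the value does not depend on the chosen compression
  \<open>\<psi>c F\<close>.\<close>

lemma h\<Gamma>_eq:
  fixes G :: "('v::finite, 'e) gain_graph"
  assumes gains: "\<And>e. e \<in> F \<Longrightarrow> gain G e \<in> \<Gamma>" and comp: "compressing_gain \<Gamma> G F (\<psi>c F)"
  shows "h\<Gamma> B Bs G \<psi>c F = int (dim (span (\<Union>e\<in>F. range (graph_vec B Bs G e)))) - 1"
proof -
  define G' where "G' = G\<lparr>gain := \<psi>c F\<rparr>"
  obtain T where sw: "switching_equiv \<Gamma> G G'" and T: "maximal_forest G F T" "\<forall>e\<in>T. \<psi>c F e = \<one>\<^bsub>euclid\<^esub>"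
    using comp unfolding compressing_gain_def G'_def by blast
  note inv = switching_equiv_invariants[of G G' F, OF sw gains]
  have gains': "\<psi>c F e \<in> \<Gamma>" if "e \<in> F" for e using inv that by (simp add: G'_def)
  have eqs: "component G' = component G" "components G' F = components G F"
      "edge_verts G' F = edge_verts G F"
    "compressed_graph G' F (gain G') = compressed_graph G F (\<psi>c F)"
    by (simp_all add: G'_def component_def components_def edge_verts_def compressed_graph_def
        fun_eq_iff)
  have U: "U B Bs (compressed_graph G F (\<psi>c F)) e
      = range (graph_vec B Bs (compressed_graph G F (\<psi>c F)) e)"
    if "e \<in> F" for e
    using orthogonal[OF gains'[OF that]] by (intro U_eq_range) (simp add: compressed_graph_def)
  have "int (dim (span (\<Union>e\<in>F. range (graph_vec B Bs G' e))))
      = 2 * int (card (edge_verts G' F)) - 2 * int (card (components G' F))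
        + int (dim (span (\<Union>e\<in>F. range (graph_vec B Bs (compressed_graph G' F (gain G')) e))))"
  proof (rule dim_contract)
    show "T \<subseteq> F" using T(1) by (simp add: maximal_forest_def)
    show "gain G' e = (mat 1, 0)" if "e \<in> T" for e using T(2) that by (simp add: G'_def euclid_one)
    show "component G' F v \<subseteq> component G' T v" for v
      unfolding eqs(1) by (rule component_maximal_forest[OF T(1)])
  qed
  moreover have "(\<Union>e\<in>edges (compressed_graph G F (\<psi>c F)). U B Bs (compressed_graph G F (\<psi>c F)) e)
      = (\<Union>e\<in>F. range (graph_vec B Bs (compressed_graph G F (\<psi>c F)) e))"
    using U by (simp add: compressed_graph_def)
  moreover have "dim (span (\<Union>e\<in>F. range (graph_vec B Bs G' e)))
      = dim (span (\<Union>e\<in>F. range (graph_vec B Bs G e)))"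
    using inv by blast
  ultimately show ?thesis unfolding h\<Gamma>_def eqs by simp
qed

section \<open>Genericity of almost all placements\<close>

text \<open>This is the open set \<open>X\<close> of the section theorem: its members are the normal
  vectors that \<open>lin_indep_placement\<close> compares with placements, and it leaves the
  lattice part free to vary.\<close>

lemma open_invertible_lat_comb:
  "open {n :: ((real^2)^'w::finite) \<times> (real^'k). invertible (lat_comb Bs (snd n))}"
proof -
  have "continuous_on UNIV (\<lambda>n :: ((real^2)^'w) \<times> (real^'k). lat_comb Bs (snd n))"
    unfolding lat_comb_def by (intro continuous_intros)
  then have "open {n :: ((real^2)^'w) \<times> (real^'k). det (lat_comb Bs (snd n)) \<noteq> 0}"
    unfolding det_2 by (intro open_Collect_neq continuous_intros)
  then show ?thesis by (simp add: invertible_det_nz)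
qed

lemma invertible_placement: "invertible (lat_comb Bs (snd (placement p)))"
proof -
  have "- (rot90 ** B) = (- rot90) ** B" by (simp add: matrix_minus_mult)
  moreover have "invertible (- rot90)"
    unfolding invertible_det_nz det_2 by (simp add: rot90_def)
  ultimately show ?thesis unfolding lat_comb_placement
      using invertible_mult[OF _ B_invertible] by simp
qed

lemma linear_vertex_difference: "linear (\<lambda>q :: (real^2)^'w::finite. q $ i - A *v (q $ j))"
  by (rule linearI) (simp_all add: matrix_vector_right_distrib matrix_vector_mult_scaleR
      scaleR_diff_right)

lemma polynomial_vertex_difference:
  "polynomial_function (\<lambda>q :: (real^2)^'w::finite. q $ i - (A *v (q $ j) + t))"
proof -
  have "polynomial_function (\<lambda>q :: (real^2)^'w. (q $ i - A *v (q $ j)) - t)"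
    by (intro polynomial_function_diff polynomial_function_const polynomial_function_bounded_linear
        linear_vertex_difference[unfolded linear_conv_bounded_linear])
  then show ?thesis by (simp add: diff_diff_eq)
qed

lemma polynomial_section_vec:
  "polynomial_function (\<lambda>q :: (real^2)^'w::finite.
     edge_vec B Bs i j \<phi> (q $ i - (A *v (q $ j) + t)) :: ((real^2)^'w) \<times> (real^'k))"
proof -
  have "bounded_linear (edge_vec B Bs i j \<phi> :: real^2 \<Rightarrow> ((real^2)^'w) \<times> (real^'k))"
    using linear_edge_vec by (simp add: linear_conv_bounded_linear)
  from polynomial_function_compose[OF polynomial_vertex_difference
      polynomial_function_bounded_linear[OF this]]
  show ?thesis by (simp add: o_def)
qed

text \<open>The direction of an edge is affine in the placement, so one independent placement yields
  a polynomial whose nonvanishing guarantees independence.\<close>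

lemma AE_lin_indep_placement:
  fixes G :: "('v::finite, 'e) gain_graph"
  assumes fin: "finite I"
    and gains: "\<And>e. e \<in> I \<Longrightarrow> gain G e \<in> \<Gamma>"
    and ends: "\<And>e. e \<in> I \<Longrightarrow> src G e \<in> V \<and> tgt G e \<in> V"
    and ind: "lin_indep_family I
        (\<lambda>e. graph_vec B Bs G e (rot90 *v graph_adj B Bs G e (placement p0)))"
  shows "AE p in Pi\<^sub>M V (\<lambda>_. lborel).
    lin_indep_family I (\<lambda>e. graph_vec B Bs G e (rot90 *v graph_adj B Bs G e (placement p)))"
proof -
  define f where "f e q = graph_vec B Bs G e
    (q $ src G e - (fst (gain G e) *v (q $ tgt G e) + snd (gain G e)))" for e and q :: "(real^2)^'v"
  let ?q = "\<lambda>p :: 'v \<Rightarrow> real^2. (\<chi> v. if v \<in> V then p v else 0) :: (real^2)^'v"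
  have f: "f e (?q p) = graph_vec B Bs G e (rot90 *v graph_adj B Bs G e (placement p))" if "e \<in> I"
      for e p
    using ends[OF that] by (simp add: f_def edge_adj_placement[OF gains[OF that]])
  have cong: "lin_indep_family I (\<lambda>e. f e (?q p))
      \<longleftrightarrow> lin_indep_family I (\<lambda>e. graph_vec B Bs G e (rot90 *v graph_adj B Bs G e (placement p)))"
          for p
    unfolding lin_indep_family_def by (simp add: f cong: sum.cong)
  obtain g where g: "real_polynomial_function g" "g (?q p0) \<noteq> 0"
    "\<And>q. g q \<noteq> 0 \<Longrightarrow> lin_indep_family I (\<lambda>e. f e q)"
    using polynomial_lin_indep_witness[OF fin, of f "?q p0"] polynomial_section_vec ind cong[of p0]
    unfolding f_def[abs_def] by blast
  have "AE p in Pi\<^sub>M V (\<lambda>_. lborel). g (?q p) \<noteq> 0"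
    using g(1,2) by (rule AE_PiM_polynomial_nonzero)
  then show ?thesis
  proof eventually_elim
    case (elim p)
    then show ?case using g(3) cong by blast
  qed
qed

text \<open>Suppose the direction vanished for all placements. The zero placement gives translation
  0, a placement supported at the source makes the edge a loop, and constant placements make its
  linear part the identity. Then the flat is zero, against \<open>nz\<close>.\<close>

lemma AE_graph_adj_placement_nonzero:
  fixes G :: "('v::finite, 'e) gain_graph"
  assumes gain: "gain G e \<in> \<Gamma>" and ends: "src G e \<in> V" "tgt G e \<in> V"
    and nz: "graph_vec B Bs G e a \<noteq> 0"
  shows "AE p in Pi\<^sub>M V (\<lambda>_. lborel). graph_adj B Bs G e (placement p) \<noteq> 0"
proof -
  define d where "d q = q $ src G e - (fst (gain G e) *v (q $ tgt G e) + snd (gain G e))"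
    for q :: "(real^2)^'v"
  let ?q = "\<lambda>p :: 'v \<Rightarrow> real^2. (\<chi> v. if v \<in> V then p v else 0) :: (real^2)^'v"
  have "\<exists>p. d (?q p) \<noteq> 0"
  proof (rule ccontr)
    assume "\<not> ?thesis"
    then have z: "p (src G e) = fst (gain G e) *v p (tgt G e) + snd (gain G e)" for p
      using ends by (simp add: d_def)
    have t: "snd (gain G e) = 0" using z[of "\<lambda>_. 0"] by simp
    have loop: "src G e = tgt G e"
    proof (rule ccontr)
      assume "src G e \<noteq> tgt G e"
      then have "axis 1 1 = (0 :: real^2)"
          using z[of "\<lambda>w. if w = src G e then axis 1 1 else 0"] t by simp
      then show False by simp
    qed
    have A: "fst (gain G e) *v v = v" for v using z[of "\<lambda>_. v"] t by simp
    have tr: "transpose (fst (gain G e)) *v a = a"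
      using orthogonal_matrix_vector_cancel(2)[OF orthogonal[OF gain], of a] unfolding A .
    then have "graph_vec B Bs G e a = 0"
      unfolding edge_vec_def tr t loop by (simp add: bvec_def vec_eq_iff zero_prod_def)
    with nz show False ..
  qed
  then obtain p0 where p0: "d (?q p0) \<noteq> 0" by blast
  then obtain b where b: "b \<in> Basis" "d (?q p0) \<bullet> b \<noteq> 0" using euclidean_all_zero_iff by blast
  have "real_polynomial_function (\<lambda>q. d q \<bullet> b)"
    using polynomial_vertex_difference b(1)
        unfolding d_def polynomial_function_iff_Basis_inner by blast
  then have "AE p in Pi\<^sub>M V (\<lambda>_. lborel). d (?q p) \<bullet> b \<noteq> 0"
    by (rule AE_PiM_polynomial_nonzero[where ?x0.0 = p0]) (rule b(2))
  then show ?thesis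
  proof eventually_elim
    case (elim p)
    have "rot90 *v graph_adj B Bs G e (placement p) = d (?q p)"
      using ends by (simp add: d_def edge_adj_placement[OF gain])
    then show ?case using elim by auto
  qed
qed

lemma R'_subset_span:
  fixes G :: "('v::finite, 'e) gain_graph" and p :: "'v \<Rightarrow> real^2"
  assumes gain: "gain G e \<in> \<Gamma>" and nz: "graph_adj B Bs G e (placement p) \<noteq> 0"
  shows "graph_vec B Bs G e (rot90 *v graph_adj B Bs G e (placement p)) \<in> R' B Bs G p e"
    and "R' B Bs G p e \<subseteq> span {graph_vec B Bs G e (rot90 *v graph_adj B Bs G e (placement p))}"
proof -
  let ?d = "rot90 *v graph_adj B Bs G e (placement p)"
  have R: "R' B Bs G p e = graph_vec B Bs G e ` {a. (rot90 *v ?d) \<bullet> a = 0}"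
    unfolding R'_eq_image[OF orthogonal[OF gain]] edge_adj_placement[OF gain] ..
  show "graph_vec B Bs G e ?d \<in> R' B Bs G p e" unfolding R by simp
  have "?d \<noteq> 0" using nz by (auto simp: vec_eq_iff forall_2)
  show "R' B Bs G p e \<subseteq> span {graph_vec B Bs G e ?d}"
  proof
    fix x assume "x \<in> R' B Bs G p e"
    then obtain a where a: "x = graph_vec B Bs G e a" "(rot90 *v ?d) \<bullet> a = 0" unfolding R by blast
    then obtain c where "a = c *\<^sub>R ?d" using parallel_if_rot90_orthogonal \<open>?d \<noteq> 0\<close> by blast
    then have "x = c *\<^sub>R graph_vec B Bs G e ?d" using a(1) linear_cmul[OF linear_edge_vec] by simp
    then show "x \<in> span {graph_vec B Bs G e ?d}" by (simp add: span_base span_scale)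
  qed
qed

theorem AE_dim_span_R'_eq_dilworth:
  fixes G :: "('v::finite, 'e) gain_graph"
  assumes G: "finite_gain_graph \<Gamma> G"
    and comp: "\<And>F. F \<subseteq> edges G \<Longrightarrow> compressing_gain \<Gamma> G F (\<psi>c F)"
  shows "AE p in Pi\<^sub>M (verts G) (\<lambda>_. lborel).
           int (dim (span (\<Union>e\<in>edges G. R' B Bs G p e))) = dilworth (h\<Gamma> B Bs G \<psi>c) (edges G)"
proof -
  interpret planar_sections "graph_vec B Bs G" "graph_adj B Bs G" by (rule planar_sections_graph)
  have fin: "finite (edges G)"
    and ends: "\<And>e. e \<in> edges G \<Longrightarrow> src G e \<in> verts G \<and> tgt G e \<in> verts G"
    and gains: "\<And>e. e \<in> edges G \<Longrightarrow> gain G e \<in> \<Gamma>"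
    using G by (auto simp: finite_gain_graph_def)
  have h: "h\<Gamma> B Bs G \<psi>c F = int (dim (flat_span F)) - 1" if "F \<subseteq> edges G" for F
    unfolding flat_span_def using that gains comp by (intro h\<Gamma>_eq) auto
  \<comment> \<open>The truncated set of edges. Since \<open>h\<Gamma>\<close> of a single edge is
    the dimension of its flat minus one, these are the edges with a nonzero flat.\<close>
  define P where "P = {e \<in> edges G. 0 \<le> h\<Gamma> B Bs G \<psi>c {e}}"
  have PE: "P \<subseteq> edges G" and finP: "finite P" using fin by (auto simp: P_def)
  have P_iff: "e \<in> P \<longleftrightarrow> (\<exists>a. graph_vec B Bs G e a \<noteq> 0)" if e: "e \<in> edges G" for e
  proof -
    have "e \<in> P \<longleftrightarrow> dim (flat_span {e}) \<noteq> 0" using e h[of "{e}"] by (simp add: P_def del: dim_eq_0)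
    also have "\<dots> \<longleftrightarrow> \<not> range (graph_vec B Bs G e) \<subseteq> {0}" by (simp add: flat_span_def)
    finally show ?thesis by blast
  qed
  let ?s = "\<lambda>e n. graph_vec B Bs G e (rot90 *v graph_adj B Bs G e n)"
  let ?X = "{n :: ((real^2)^'v) \<times> (real^'k). invertible (lat_comb Bs (snd n))}"
  have "AE p in Pi\<^sub>M (verts G) (\<lambda>_. lborel). \<forall>e\<in>P. graph_adj B Bs G e (placement p) \<noteq> 0"
  proof (rule AE_finite_allI[OF finP])
    fix e assume "e \<in> P"
    then obtain a where e: "e \<in> edges G" and a: "graph_vec B Bs G e a \<noteq> 0" using P_iff PE by blast
    show "AE p in Pi\<^sub>M (verts G) (\<lambda>_. lborel). graph_adj B Bs G e (placement p) \<noteq> 0"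
      using ends[OF e] by (intro AE_graph_adj_placement_nonzero[OF gains[OF e] _ _ a]) simp_all
  qed
  \<comment> \<open>There are finitely many sets \<open>I\<close>, so the exceptional null sets may
    be united; the result is the hypothesis \<open>generic\<close> of the section theorem at
    \<open>placement p\<close>.\<close>
  moreover have "AE p in Pi\<^sub>M (verts G) (\<lambda>_. lborel). \<forall>I\<in>Pow P.
      (\<exists>n\<in>?X. lin_indep_family I (\<lambda>e. ?s e n)) \<longrightarrow> lin_indep_family I (\<lambda>e. ?s e (placement p))"
  proof (rule AE_finite_allI)
    fix I assume I: "I \<in> Pow P"
    show "AE p in Pi\<^sub>M (verts G) (\<lambda>_. lborel).
        (\<exists>n\<in>?X. lin_indep_family I (\<lambda>e. ?s e n)) \<longrightarrow> lin_indep_family I (\<lambda>e. ?s e (placement p))"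
    proof (cases "\<exists>n\<in>?X. lin_indep_family I (\<lambda>e. ?s e n)")
      case True
      then obtain n where n: "invertible (lat_comb Bs (snd n))" "lin_indep_family I (\<lambda>e. ?s e n)"
          by blast
      have gI: "gain G e \<in> \<Gamma>" "src G e \<in> verts G \<and> tgt G e \<in> verts G" if "e \<in> I" for e
        using that I PE gains ends by blast+
      obtain p0 where p0: "lin_indep_family I (\<lambda>e. ?s e (placement p0))"
        by (rule lin_indep_placement[OF gI(1) n])
      have "finite I" using I finP finite_subset by blast
      then have "AE p in Pi\<^sub>M (verts G) (\<lambda>_. lborel). lin_indep_family I (\<lambda>e. ?s e (placement p))"
        by (rule AE_lin_indep_placement[OF _ gI p0])
      then show ?thesis by eventually_elim simp
    next
      case False
      then show ?thesis by (intro AE_I2 impI) blast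
    qed
  qed (simp add: finP)
  ultimately show ?thesis
  proof eventually_elim
    case (elim p)
    let ?n = "placement p"
    have "span (\<Union>e\<in>edges G. R' B Bs G p e) = section_span ?n P"
    proof (rule subset_antisym)
      show "span (\<Union>e\<in>edges G. R' B Bs G p e) \<subseteq> section_span ?n P"
      proof (rule span_minimal)
        show "(\<Union>e\<in>edges G. R' B Bs G p e) \<subseteq> section_span ?n P"
        proof (rule UN_least)
          fix e assume e: "e \<in> edges G"
          show "R' B Bs G p e \<subseteq> section_span ?n P"
          proof (cases "e \<in> P")
            case True
            then have "section_vec e ?n \<in> (\<lambda>e. section_vec e ?n) ` P" by blast
            then have "span {section_vec e ?n} \<subseteq> section_span ?n P"
              unfolding section_span_def by (intro span_mono) simp
            then show ?thesis
              using R'_subset_span(2)[OF gains[OF e]] elim(1) True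
                  unfolding section_vec_def by blast
          next
            \<comment> \<open>A discarded edge has the zero flat, so its \<open>R'\<close> adds
              nothing to the span.\<close>
            case False
            then have "graph_vec B Bs G e a = 0" for a using P_iff[OF e] by blast
            then show ?thesis
              unfolding R'_eq_image[of G e, OF orthogonal[OF gains[OF e]]]
              by (auto simp: section_span_def span_zero)
          qed
        qed
      qed (simp add: section_span_def)
      have "section_vec e ?n \<in> R' B Bs G p e" if "e \<in> P" for e
        unfolding section_vec_def using that PE elim(1) gains
        by (intro R'_subset_span(1)) auto
      then show "section_span ?n P \<subseteq> span (\<Union>e\<in>edges G. R' B Bs G p e)"
        unfolding section_span_def using PE by (intro span_mono) blast
    qed
    then have lhs: "int (dim (span (\<Union>e\<in>edges G. R' B Bs G p e))) = int (dim (section_span ?n P))"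
        by simp
    have "Min {\<Sum>F\<in>\<P>. int (dim (flat_span F)) - 1 | \<P>. partition_on P \<P>}
        = int (dim (section_span ?n P))"
    proof (rule dim_section_span_eq_Min[OF finP open_invertible_lat_comb])
      show "?n \<in> ?X" using invertible_placement by simp
      show "graph_adj B Bs G e ?n \<noteq> 0" if "e \<in> P" for e using elim(1) that by blast
      show "lin_indep_family I (\<lambda>e. section_vec e ?n)"
        if "I \<subseteq> P" "n \<in> ?X" "lin_indep_family I (\<lambda>e. section_vec e n)" for I n
        using elim(2) that unfolding section_vec_def by blast
    qed
    moreover have "{\<Sum>F\<in>\<P>. h\<Gamma> B Bs G \<psi>c F | \<P>. partition_on P \<P>}
        = {\<Sum>F\<in>\<P>. int (dim (flat_span F)) - 1 | \<P>. partition_on P \<P>}"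
    proof -
      have "(\<Sum>F\<in>\<P>. h\<Gamma> B Bs G \<psi>c F) = (\<Sum>F\<in>\<P>. int (dim (flat_span F)) - 1)"
        if "partition_on P \<P>" for \<P>
      proof (rule sum.cong[OF refl h])
        show "F \<subseteq> edges G" if "F \<in> \<P>" for F
          using that \<open>partition_on P \<P>\<close> PE by (auto simp: partition_on_def)
      qed
      then show ?thesis unfolding setcompr_eq_image by (intro image_cong refl) simp
    qed
    \<comment> \<open>Matches the separate clause of \<open>dilworth\<close>, whose value is 0 when
      the truncation removes every edge.\<close>
    moreover have "int (dim (section_span ?n P)) = 0" if "P = {}"
      unfolding that by (simp add: section_span_def)
    ultimately show ?case unfolding lhs dilworth_def Let_def P_def[symmetric] by simp
  qed
qed

end

theorem theorem10p9:
  fixes \<Gamma> :: "isom set"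
    and B :: "real^2^2"
    and Bs :: "'k::finite \<Rightarrow> real^2^2"
    and G :: "('v::finite, 'e) gain_graph"
    and \<psi>c :: "'e set \<Rightarrow> 'e \<Rightarrow> isom"
  assumes "space_group \<Gamma>"
    and "\<And>A. A \<in> linear_part \<Gamma> \<Longrightarrow> rotation_matrix A"
    and "lattice_matrix \<Gamma> B"
    and "Lat_basis \<Gamma> B Bs"
    and "generic_lattice \<Gamma> B Bs"
    and "finite_gain_graph \<Gamma> G"
    and "\<And>F. F \<subseteq> edges G \<Longrightarrow> compressing_gain \<Gamma> G F (\<psi>c F)"
  shows "AE p in Pi\<^sub>M (verts G) (\<lambda>_. lborel).
           int (dim (span (\<Union>e\<in>edges G. R' B Bs G p e))) = dilworth (h\<Gamma> B Bs G \<psi>c) (edges G)"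
proof -
  interpret rotation_lattice \<Gamma> B Bs
  proof (rule rotation_lattice.intro)
    show "subgroup \<Gamma> euclid" using assms(1) by (simp add: space_group_def)
    show "invertible B" using assms(3) by (simp add: lattice_matrix_def)
    show "rotation_matrix (fst \<gamma>)" if "\<gamma> \<in> \<Gamma>" for \<gamma>
      using assms(2) that by (simp add: linear_part_def)
  qed (rule assms(4))
  show ?thesis using assms(6,7) by (rule AE_dim_span_R'_eq_dilworth)
qed

end
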